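(* Let $R\subseteq T$ be rings forming a regular conductor square with conductor $C$, and set $A=R/C$, $B=T/C$. Assume that $T$ is flat as an $R$-module, that $C$ is a principal ideal of $T$, and that every non-zero finitely generated ideal $I$ of $R$ satisfies the following condition: there is an ideal $I'$ of $R$ isomorphic to $I$ (as an $R$-module) such that $I'T=T$. If $A$ is coherent, then so are $R$ and $T$.
   Context: All rings are commutative with identity. A conductor square consists of a ring $T$, a subring $R\subseteq T$ such that $R$ and $T$ have a common non-zero ideal, the largest common ideal $C$ of $R$ and $T$ (called the conductor of $T$ into $R$), and the rings $A=R/C$ and $B=T/C$, together with the inclusions $R\hookrightarrow T$, $A\hookrightarrow B$ and the projections $\eta_2\colon R\twoheadrightarrow A$, $\eta_1\colon T\twoheadrightarrow B$; equivalently, $R$ is the pullback $\{(a,t)\in A\times T\mid a=\eta_1(t)\text{ in }B\}$ and $C=\operatorname{Ker}(\eta_1)=\operatorname{Ker}(\eta_2)$ is the largest common ideal. The square is regular if $C$ contains a non-zero-divisor of $T$. A ring is coherent if every finitely generated ideal of it is finitely presented. *)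

theory Defs
  imports "HOL-Algebra.Module" "HOL-Algebra.QuotRing" "HOL-Algebra.Subrings"
    "HOL-Algebra.Free_Abelian_Groups"
begin

section \<open>Modules\<close>

definition linear_maps ::
    "('a, 'p) ring_scheme \<Rightarrow> ('a, 'm, 'q) module_scheme \<Rightarrow> ('a, 'n, 'r) module_scheme \<Rightarrow> ('m \<Rightarrow> 'n) set"
  where "linear_maps R M N =
    {f \<in> carrier M \<rightarrow> carrier N.
       (\<forall>x\<in>carrier M. \<forall>y\<in>carrier M. f (x \<oplus>\<^bsub>M\<^esub> y) = f x \<oplus>\<^bsub>N\<^esub> f y) \<and>
       (\<forall>a\<in>carrier R. \<forall>x\<in>carrier M. f (a \<odot>\<^bsub>M\<^esub> x) = a \<odot>\<^bsub>N\<^esub> f x)}"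

definition module_iso ::
    "('a, 'p) ring_scheme \<Rightarrow> ('a, 'm, 'q) module_scheme \<Rightarrow> ('a, 'n, 'r) module_scheme \<Rightarrow> bool"
  where "module_iso R M N \<longleftrightarrow> (\<exists>f\<in>linear_maps R M N. bij_betw f (carrier M) (carrier N))"

text \<open>
  An additive subgroup \<open>X\<close> of a ring \<open>S\<close>, regarded as a module over a subring of \<open>S\<close> (or over
  \<open>S\<close> itself) whose elements map \<open>X\<close> to itself by multiplication. For an ideal \<open>I\<close> of \<open>S\<close> the
  \<open>S\<close>-module \<open>I\<close> is \<open>mult_module S I\<close>; for a subring \<open>R\<close> of \<open>S\<close> the \<open>R\<close>-module \<open>S\<close> is
  \<open>mult_module S (carrier S)\<close>. The multiplicative fields of the record play no role.
\<close>

definition mult_module :: "('a, 'p) ring_scheme \<Rightarrow> 'a set \<Rightarrow> ('a, 'a) module"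
  where "mult_module S X =
    \<lparr>carrier = X, monoid.mult = (\<otimes>\<^bsub>S\<^esub>), one = \<one>\<^bsub>S\<^esub>, ring.zero = \<zero>\<^bsub>S\<^esub>,
     add = (\<oplus>\<^bsub>S\<^esub>), smult = (\<otimes>\<^bsub>S\<^esub>)\<rparr>"

definition free_module :: "('a, 'p) ring_scheme \<Rightarrow> nat \<Rightarrow> ('a, nat \<Rightarrow> 'a) module"
  where "free_module R n =
    \<lparr>carrier = {..<n} \<rightarrow>\<^sub>E carrier R,
     monoid.mult = (\<lambda>x y. \<lambda>i\<in>{..<n}. x i \<otimes>\<^bsub>R\<^esub> y i),
     one = (\<lambda>i\<in>{..<n}. \<one>\<^bsub>R\<^esub>),
     ring.zero = (\<lambda>i\<in>{..<n}. \<zero>\<^bsub>R\<^esub>),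
     add = (\<lambda>x y. \<lambda>i\<in>{..<n}. x i \<oplus>\<^bsub>R\<^esub> y i),
     smult = (\<lambda>a x. \<lambda>i\<in>{..<n}. a \<otimes>\<^bsub>R\<^esub> x i)\<rparr>"

text \<open>Existence of an exact sequence \<open>R\<^sup>m \<rightarrow> R\<^sup>n \<rightarrow> M \<rightarrow> 0\<close>.\<close>

definition finitely_presented :: "('a, 'p) ring_scheme \<Rightarrow> ('a, 'm, 'q) module_scheme \<Rightarrow> bool"
  where "finitely_presented R M \<longleftrightarrow> module R M \<and>
    (\<exists>m n. \<exists>f\<in>linear_maps R (free_module R m) (free_module R n).
       \<exists>g\<in>linear_maps R (free_module R n) M.
         f ` carrier (free_module R m) = {x \<in> carrier (free_module R n). g x = \<zero>\<^bsub>M\<^esub>} \<and>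
         g ` carrier (free_module R n) = carrier M)"


section \<open>Coherent rings\<close>

definition fg_ideal :: "'a set \<Rightarrow> ('a, 'p) ring_scheme \<Rightarrow> bool"
  where "fg_ideal I R \<longleftrightarrow> ideal I R \<and> (\<exists>S\<subseteq>carrier R. finite S \<and> I = Idl\<^bsub>R\<^esub> S)"

definition coherent_ring :: "('a, 'p) ring_scheme \<Rightarrow> bool"
  where "coherent_ring R \<longleftrightarrow> cring R \<and> (\<forall>I. fg_ideal I R \<longrightarrow> finitely_presented R (mult_module R I))"


section \<open>Tensor products and flatness\<close>

text \<open>
  \<open>M \<otimes>\<^sub>R N\<close> as an abelian group: the free abelian group on \<open>M \<times> N\<close> modulo the subgroup
  generated by the bilinearity and balancing relations.
\<close>

definition tensor_relators ::
    "('a, 'p) ring_scheme \<Rightarrow> ('a, 'm, 'q) module_scheme \<Rightarrow> ('a, 'n, 'r) module_scheme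
      \<Rightarrow> ('m \<times> 'n \<Rightarrow>\<^sub>0 int) set"
  where "tensor_relators R M N =
    {frag_of (x \<oplus>\<^bsub>M\<^esub> x', y) - frag_of (x, y) - frag_of (x', y) | x x' y.
       x \<in> carrier M \<and> x' \<in> carrier M \<and> y \<in> carrier N} \<union>
    {frag_of (x, y \<oplus>\<^bsub>N\<^esub> y') - frag_of (x, y) - frag_of (x, y') | x y y'.
       x \<in> carrier M \<and> y \<in> carrier N \<and> y' \<in> carrier N} \<union>
    {frag_of (a \<odot>\<^bsub>M\<^esub> x, y) - frag_of (x, a \<odot>\<^bsub>N\<^esub> y) | a x y.
       a \<in> carrier R \<and> x \<in> carrier M \<and> y \<in> carrier N}"

definition tensor_null ::
    "('a, 'p) ring_scheme \<Rightarrow> ('a, 'm, 'q) module_scheme \<Rightarrow> ('a, 'n, 'r) module_scheme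
      \<Rightarrow> ('m \<times> 'n \<Rightarrow>\<^sub>0 int) set"
  where "tensor_null R M N =
    generate (free_Abelian_group (carrier M \<times> carrier N)) (tensor_relators R M N)"

definition tensor_product ::
    "('a, 'p) ring_scheme \<Rightarrow> ('a, 'm, 'q) module_scheme \<Rightarrow> ('a, 'n, 'r) module_scheme
      \<Rightarrow> ('m \<times> 'n \<Rightarrow>\<^sub>0 int) set monoid"
  where "tensor_product R M N =
    free_Abelian_group (carrier M \<times> carrier N) Mod tensor_null R M N"

text \<open>
  The map \<open>f \<otimes> id : M \<otimes> N \<rightarrow> M' \<otimes> N\<close> induced by a linear map \<open>f : M \<rightarrow> M'\<close>. The sets in the union
  all coincide, see \<open>tensor_map_coset\<close> below.
\<close>

definition tensor_map ::
    "('a, 'p) ring_scheme \<Rightarrow> ('a, 'm, 'q) module_scheme \<Rightarrow> ('a, 'm', 's) module_scheme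
      \<Rightarrow> ('a, 'n, 'r) module_scheme \<Rightarrow> ('m \<Rightarrow> 'm')
      \<Rightarrow> ('m \<times> 'n \<Rightarrow>\<^sub>0 int) set \<Rightarrow> ('m' \<times> 'n \<Rightarrow>\<^sub>0 int) set"
  where "tensor_map R M M' N f X =
    (\<Union>z\<in>X. tensor_null R M' N #>\<^bsub>free_Abelian_group (carrier M' \<times> carrier N)\<^esub>
              frag_extend (\<lambda>(x, y). frag_of (f x, y)) z)"

text \<open>
  \<open>N\<close> is flat if \<open>_ \<otimes>\<^sub>R N\<close> preserves injectivity. A definition cannot quantify over types, so
  the test modules are those with carrier in the type \<^typ>\<open>'a list set\<close>. This loses nothing: up to
  isomorphism every finitely generated \<open>R\<close>-module occurs there (its elements being cosets in some
  \<open>R\<^sup>n\<close>), and a module is flat iff tensoring with it preserves injections between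
  finitely generated modules.
\<close>

definition flat_module :: "('a, 'p) ring_scheme \<Rightarrow> ('a, 'n, 'r) module_scheme \<Rightarrow> bool"
  where "flat_module R N \<longleftrightarrow> module R N \<and>
    (\<forall>(M :: ('a, 'a list set) module) (M' :: ('a, 'a list set) module).
       \<forall>f\<in>linear_maps R M M'.
         module R M \<and> module R M' \<and> inj_on f (carrier M) \<longrightarrow>
         inj_on (tensor_map R M M' N f) (carrier (tensor_product R M N)))"


section \<open>Conductor squares\<close>

text \<open>
  A subring of \<open>T\<close> is given by its carrier \<open>R\<close>; as a ring it is \<open>T\<lparr>carrier := R\<rparr>\<close>. The two quotient
  rings of the square are \<open>T\<lparr>carrier := R\<rparr> Quot C\<close> and \<open>T Quot C\<close>.
\<close>

definition common_ideal :: "('a, 'p) ring_scheme \<Rightarrow> 'a set \<Rightarrow> 'a set \<Rightarrow> bool"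
  where "common_ideal T R J \<longleftrightarrow> ideal J T \<and> ideal J (T\<lparr>carrier := R\<rparr>)"

definition conductor_square :: "('a, 'p) ring_scheme \<Rightarrow> 'a set \<Rightarrow> 'a set \<Rightarrow> bool"
  where "conductor_square T R C \<longleftrightarrow>
    cring T \<and> subcring R T \<and>
    (\<exists>J. common_ideal T R J \<and> J \<noteq> {\<zero>\<^bsub>T\<^esub>}) \<and>
    common_ideal T R C \<and> (\<forall>J. common_ideal T R J \<longrightarrow> J \<subseteq> C)"

definition non_zero_divisor :: "('a, 'p) ring_scheme \<Rightarrow> 'a \<Rightarrow> bool"
  where "non_zero_divisor T c \<longleftrightarrow>
    c \<in> carrier T \<and> (\<forall>x\<in>carrier T. c \<otimes>\<^bsub>T\<^esub> x = \<zero>\<^bsub>T\<^esub> \<longrightarrow> x = \<zero>\<^bsub>T\<^esub>)"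

definition regular_conductor_square :: "('a, 'p) ring_scheme \<Rightarrow> 'a set \<Rightarrow> 'a set \<Rightarrow> bool"
  where "regular_conductor_square T R C \<longleftrightarrow>
    conductor_square T R C \<and> (\<exists>c\<in>C. non_zero_divisor T c)"


section \<open>Basic facts\<close>

lemma module_mult_module_ideal:
  assumes "cring S" "ideal I S"
  shows "module S (mult_module S I)"
proof -
  interpret S: cring S by fact
  interpret I: ideal I S by fact
  have sub: "x \<in> carrier S" if "x \<in> I" for x using that I.a_subset by blast
  show ?thesis
    by (rule moduleI)
      (auto simp: mult_module_def assms sub I.I_l_closed S.l_distr S.r_distr S.m_assoc
        S.a_ac I.a_closed
        intro!: abelian_groupI bexI[of _ "\<ominus>\<^bsub>S\<^esub> x" for x] I.a_inv_closed S.l_neg S.r_neg)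
qed

lemma module_mult_module_subring:
  assumes "cring S" "subcring R S"
  shows "module (S\<lparr>carrier := R\<rparr>) (mult_module S (carrier S))"
proof -
  interpret S: cring S by fact
  have sub: "x \<in> carrier S" if "x \<in> R" for x
    using that subringE(1)[OF subcring.axioms(1)[OF assms(2)]] by blast
  have "abelian_group (mult_module S (carrier S))"
    by (rule abelian_groupI)
      (auto simp: mult_module_def S.a_ac
        intro!: bexI[of _ "\<ominus>\<^bsub>S\<^esub> x" for x] S.l_neg)
  moreover have "cring (S\<lparr>carrier := R\<rparr>)"
    using S.subcring_iff[of R] assms(2) sub by blast
  ultimately show ?thesis
    by (intro moduleI)
      (auto simp: mult_module_def sub S.l_distr S.r_distr S.m_assoc)
qed

lemma module_free_module:
  assumes "cring R"
  shows "module R (free_module R n)"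
proof -
  interpret R: cring R by fact
  have "abelian_group (free_module R n)"
  proof (rule abelian_groupI)
    fix x assume "x \<in> carrier (free_module R n)"
    then show "\<exists>y\<in>carrier (free_module R n). y \<oplus>\<^bsub>free_module R n\<^esub> x = \<zero>\<^bsub>free_module R n\<^esub>"
      by (intro bexI[of _ "\<lambda>i\<in>{..<n}. \<ominus>\<^bsub>R\<^esub> x i"])
        (auto simp: free_module_def PiE_iff R.l_neg intro!: restrict_ext)
  qed (auto simp: free_module_def PiE_iff R.a_ac extensional_def fun_eq_iff)
  then show ?thesis
    by (intro moduleI)
      (auto simp: free_module_def assms PiE_iff R.l_distr R.r_distr R.m_assoc extensional_def
        fun_eq_iff)
qed

lemma frag_extend_tensor_null:
  assumes f: "f \<in> linear_maps R M M'" and M: "module R M" and N: "module R N"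
    and z: "z \<in> tensor_null R M N"
  shows "frag_extend (\<lambda>(x, y). frag_of (f x, y)) z \<in> tensor_null R M' N"
proof -
  interpret M: module R M by fact
  interpret N: module R N by fact
  let ?G = "free_Abelian_group (carrier M \<times> carrier N)"
  let ?G' = "free_Abelian_group (carrier M' \<times> carrier N)"
  let ?F = "frag_extend (\<lambda>(x, y). frag_of (f x, y))"
  have F: "f x \<in> carrier M'" if "x \<in> carrier M" for x
    using f that by (auto simp: linear_maps_def)
  have F1: "f (x \<oplus>\<^bsub>M\<^esub> y) = f x \<oplus>\<^bsub>M'\<^esub> f y" if "x \<in> carrier M" "y \<in> carrier M" for x y
    using f that by (auto simp: linear_maps_def)
  have F2: "f (a \<odot>\<^bsub>M\<^esub> x) = a \<odot>\<^bsub>M'\<^esub> f x" if "a \<in> carrier R" "x \<in> carrier M" for a x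
    using f that by (auto simp: linear_maps_def)
  have rel: "?F h \<in> tensor_relators R M' N" if "h \<in> tensor_relators R M N" for h
    using that unfolding tensor_relators_def
    apply (elim UnE)
      apply (rule UnI1, rule UnI1)
      apply (clarsimp simp: frag_extend_diff F1) using F apply blast
     apply (rule UnI1, rule UnI2)
     apply (clarsimp simp: frag_extend_diff) using F apply blast
    apply (rule UnI2)
    apply (clarsimp simp: frag_extend_diff F2) using F apply blast
    done
  have keys: "Poly_Mapping.keys h \<subseteq> carrier M \<times> carrier N" if "h \<in> tensor_relators R M N" for h
    using that unfolding tensor_relators_def
    by (auto dest!: subsetD[OF keys_diff] simp: keys_frag_of)
  have keys': "Poly_Mapping.keys (?F h) \<subseteq> carrier M' \<times> carrier N"
    if "h \<in> tensor_relators R M N" for h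
    using keys[OF that] F by (auto dest!: subsetD[OF keys_frag_extend])
  show ?thesis
    using z unfolding tensor_null_def
  proof (induction rule: generate.induct)
    case one
    then show ?case by (metis generate.one frag_extend_0 one_free_Abelian_group)
  next
    case (incl h)
    then show ?case using rel generate.incl by metis
  next
    case (inv h)
    have "?F (inv\<^bsub>?G\<^esub> h) = inv\<^bsub>?G'\<^esub> (?F h)"
      using keys[OF inv] keys'[OF inv] by (simp add: frag_extend_minus)
    then show ?case using generate.inv[OF rel[OF inv]] by metis
  next
    case (eng h1 h2)
    then show ?case using generate.eng by (fastforce simp: frag_extend_add)
  qed
qed

lemma tensor_map_coset:
  assumes f: "f \<in> linear_maps R M M'" and M: "module R M" and M': "module R M'"
    and N: "module R N" and z: "Poly_Mapping.keys z \<subseteq> carrier M \<times> carrier N"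
  shows "tensor_map R M M' N f
      (tensor_null R M N #>\<^bsub>free_Abelian_group (carrier M \<times> carrier N)\<^esub> z) =
    tensor_null R M' N #>\<^bsub>free_Abelian_group (carrier M' \<times> carrier N)\<^esub>
      frag_extend (\<lambda>(x, y). frag_of (f x, y)) z"
proof -
  interpret M: module R M by fact
  interpret M': module R M' by fact
  interpret N: module R N by fact
  let ?G' = "free_Abelian_group (carrier M' \<times> carrier N)"
  let ?F = "frag_extend (\<lambda>(x, y). frag_of (f x, y))"
  have rel: "tensor_relators R M' N \<subseteq> carrier ?G'"
    unfolding tensor_relators_def
    by (auto dest!: subsetD[OF keys_diff] simp: keys_frag_of)
  interpret G': group ?G' by simp
  have sg: "subgroup (tensor_null R M' N) ?G'"
    unfolding tensor_null_def by (rule G'.generate_is_subgroup[OF rel])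
  have Fz: "?F z \<in> carrier ?G'"
    using z f by (auto simp: linear_maps_def dest!: subsetD[OF keys_frag_extend])
  have *: "tensor_null R M' N #>\<^bsub>?G'\<^esub> ?F (k + z) = tensor_null R M' N #>\<^bsub>?G'\<^esub> ?F z"
    if k: "k \<in> tensor_null R M N" for k
  proof -
    have "?F k \<in> tensor_null R M' N" by (rule frag_extend_tensor_null[OF f M N k])
    then have "?F k \<otimes>\<^bsub>?G'\<^esub> ?F z \<in> tensor_null R M' N #>\<^bsub>?G'\<^esub> ?F z"
      unfolding r_coset_def by blast
    then show ?thesis
      using G'.repr_independence[OF _ Fz sg] by (simp add: frag_extend_add)
  qed
  have "0 \<in> tensor_null R M N"
    unfolding tensor_null_def by (metis generate.one one_free_Abelian_group)
  then show ?thesis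
    unfolding tensor_map_def by (auto simp: r_coset_def[of "free_Abelian_group (carrier M \<times> _)"] *)
qed

end

theory Submission
  imports Defs
begin

text \<open>
  A ring is coherent iff every finite family in it has a finitely generated module of syzygies.
  Flatness of \<open>T\<close> says that the syzygies over \<open>T\<close> of a family in \<open>R\<close> are spanned by the syzygies
  over \<open>R\<close>.

  The hypothesis on ideals lets one replace a family in \<open>R\<close> by one with the same syzygies that spans
  the unit ideal of \<open>T\<close>. Its syzygies over \<open>T\<close> are then finitely generated, because the unit ideal
  is free, and those over \<open>A\<close> are so by coherence; together they yield finitely many generators
  over \<open>R\<close>. Finally, multiplication by the generator \<open>c\<close> of \<open>C\<close>, a non-zero-divisor, carries
  any family in \<open>T\<close> to a family in \<open>R\<close> with the same syzygies over \<open>T\<close>, so coherence passes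
  from \<open>R\<close> to \<open>T\<close>.
\<close>

text \<open>The weak point is that finitely many syzygies spanning over \<open>T\<close> need not
  span over \<open>R\<close>. The conductor repairs this: \<open>cT\<close> lies in
  \<open>R\<close>, so \<open>c\<close> times a \<open>T\<close>-combination is an
  \<open>R\<close>-combination. Syzygies with entries in \<open>C\<close> are thereby controlled,
  and only residues modulo \<open>C\<close> remain. For these the condition \<open>I'T = T\<close>
  acts a second time: if 1 is the sum of the \<open>u_i x_i\<close> over \<open>T\<close>, any
  \<open>d\<close> in \<open>C\<close> is the sum of the \<open>(d u_i) x_i\<close>, whose
  coefficients lie in \<open>C\<close>. A syzygy modulo \<open>C\<close> can therefore be corrected
  to a syzygy over \<open>R\<close> without changing its residue.

  Flatness is applied to the inclusion of one finitely generated ideal \<open>I\<close> into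
  \<open>R\<close>. A syzygy \<open>t\<close> over \<open>T\<close> of generators \<open>x_i\<close>
  makes the sum of the \<open>x_i \<otimes> t_i\<close> vanish in \<open>R \<otimes> T\<close>,
  hence in \<open>I \<otimes> T\<close>. To read this off in coordinates,
  \<open>a \<otimes> s\<close> is sent to \<open>s\<close> times a coefficient vector chosen for
  \<open>a\<close>; the choice is ambiguous only by syzygies over \<open>R\<close>.\<close>

section \<open>Spans, linear combinations and finite presentation\<close>

lemma free_module_simps:
  "carrier (free_module R n) = {..<n} \<rightarrow>\<^sub>E carrier R"
  "\<zero>\<^bsub>free_module R n\<^esub> = (\<lambda>i\<in>{..<n}. \<zero>\<^bsub>R\<^esub>)"
  "x \<oplus>\<^bsub>free_module R n\<^esub> y = (\<lambda>i\<in>{..<n}. x i \<oplus>\<^bsub>R\<^esub> y i)"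
  "a \<odot>\<^bsub>free_module R n\<^esub> x = (\<lambda>i\<in>{..<n}. a \<otimes>\<^bsub>R\<^esub> x i)"
  by (simp_all add: free_module_def)

lemma mult_module_simps:
  "carrier (mult_module S X) = X" "\<zero>\<^bsub>mult_module S X\<^esub> = \<zero>\<^bsub>S\<^esub>"
  "x \<oplus>\<^bsub>mult_module S X\<^esub> y = x \<oplus>\<^bsub>S\<^esub> y" "a \<odot>\<^bsub>mult_module S X\<^esub> x = a \<otimes>\<^bsub>S\<^esub> x"
  by (simp_all add: mult_module_def)

lemma linear_mapsD:
  assumes "f \<in> linear_maps R M N"
  shows "x \<in> carrier M \<Longrightarrow> f x \<in> carrier N"
    and "x \<in> carrier M \<Longrightarrow> y \<in> carrier M \<Longrightarrow> f (x \<oplus>\<^bsub>M\<^esub> y) = f x \<oplus>\<^bsub>N\<^esub> f y"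
    and "a \<in> carrier R \<Longrightarrow> x \<in> carrier M \<Longrightarrow> f (a \<odot>\<^bsub>M\<^esub> x) = a \<odot>\<^bsub>N\<^esub> f x"
  using assms by (auto simp: linear_maps_def)

lemma linear_map_zero:
  assumes "module R M" "module R N" "f \<in> linear_maps R M N"
  shows "f \<zero>\<^bsub>M\<^esub> = \<zero>\<^bsub>N\<^esub>"
proof -
  interpret M: module R M by fact
  interpret N: module R N by fact
  have "f (\<zero>\<^bsub>R\<^esub> \<odot>\<^bsub>M\<^esub> \<zero>\<^bsub>M\<^esub>) = \<zero>\<^bsub>R\<^esub> \<odot>\<^bsub>N\<^esub> f \<zero>\<^bsub>M\<^esub>"
    using linear_mapsD(3)[OF assms(3)] by blast
  then show ?thesis using linear_mapsD(1)[OF assms(3)] by simp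
qed

lemma linear_map_comp:
  assumes "f \<in> linear_maps R M N" "g \<in> linear_maps R N P"
  shows "(\<lambda>x. g (f x)) \<in> linear_maps R M P"
  using assms unfolding linear_maps_def by (auto simp: Pi_iff)

lemma linear_map_diff:
  assumes "module R M" "module R N" "f \<in> linear_maps R M N" "x \<in> carrier M" "y \<in> carrier M"
  shows "f (x \<ominus>\<^bsub>M\<^esub> y) = f x \<ominus>\<^bsub>N\<^esub> f y"
proof -
  interpret M: module R M by fact
  interpret N: module R N by fact
  note f = linear_mapsD[OF assms(3)]
  have "f (x \<ominus>\<^bsub>M\<^esub> y) \<oplus>\<^bsub>N\<^esub> f y = f x"
    using f(2)[of "x \<ominus>\<^bsub>M\<^esub> y" y] assms(4,5) by (simp add: a_minus_def M.a_assoc M.l_neg)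
  then show ?thesis using f(1) assms(4,5)
    by (metis M.minus_closed N.add.inv_solve_right' a_minus_def)
qed

lemma linear_map_finsum:
  assumes "module R M" "module R N" "f \<in> linear_maps R M N"
    and "finite A" "v \<in> A \<rightarrow> carrier M"
  shows "f (\<Oplus>\<^bsub>M\<^esub>i\<in>A. v i) = (\<Oplus>\<^bsub>N\<^esub>i\<in>A. f (v i))"
proof -
  interpret M: module R M by fact
  interpret N: module R N by fact
  note f = linear_mapsD[OF assms(3)]
  show ?thesis using assms(4,5)
    by (induction rule: finite_induct)
      (simp_all add: linear_map_zero[OF assms(1-3)] f Pi_iff)
qed

text \<open>\<open>finsum\<close> folds over the carrier of its structure, so a sum formed in an
  ideal or a subring is not literally the sum in the larger ring. Agreement of zero and addition on
  the smaller carrier forces equality by induction.\<close>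

lemma finsum_carrier_mono:
  assumes "abelian_monoid G" "abelian_monoid H"
    and "carrier G \<subseteq> carrier H" "\<zero>\<^bsub>G\<^esub> = \<zero>\<^bsub>H\<^esub>"
    and "\<And>x y. x \<in> carrier G \<Longrightarrow> y \<in> carrier G \<Longrightarrow> x \<oplus>\<^bsub>G\<^esub> y = x \<oplus>\<^bsub>H\<^esub> y"
    and "finite A" "f \<in> A \<rightarrow> carrier G"
  shows "(\<Oplus>\<^bsub>G\<^esub>i\<in>A. f i) = (\<Oplus>\<^bsub>H\<^esub>i\<in>A. f i)"
proof -
  interpret G: abelian_monoid G by fact
  interpret H: abelian_monoid H by fact
  show ?thesis using assms(6,7)
  proof (induction rule: finite_induct)
    case (insert a A)
    have f: "(\<Oplus>\<^bsub>G\<^esub>i\<in>A. f i) \<in> carrier G" "f a \<in> carrier G" "f \<in> A \<rightarrow> carrier H"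
      "f a \<in> carrier H" "f \<in> A \<rightarrow> carrier G"
      using insert.prems assms(3) by (auto intro!: G.finsum_closed)
    have "f a \<oplus>\<^bsub>G\<^esub> (\<Oplus>\<^bsub>G\<^esub>i\<in>A. f i) = f a \<oplus>\<^bsub>H\<^esub> (\<Oplus>\<^bsub>G\<^esub>i\<in>A. f i)"
      by (rule assms(5)[OF f(2,1)])
    then show ?case using insert f by simp
  qed (simp add: assms(4))
qed

text \<open>Adding one multiple of a generator at a time avoids choosing index sets and coefficient
  families, also for infinite \<open>G\<close>. The rules refer to the operations of
  \<open>M\<close> but not to its carrier, so spans in different modules with the same operations
  can be compared directly.\<close>

inductive_set lin_span :: "('a, 'p) ring_scheme \<Rightarrow> ('a, 'm, 'q) module_scheme \<Rightarrow> 'm set \<Rightarrow> 'm set"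
  for R M G where
  zero: "\<zero>\<^bsub>M\<^esub> \<in> lin_span R M G"
| step: "a \<in> carrier R \<Longrightarrow> g \<in> G \<Longrightarrow> x \<in> lin_span R M G \<Longrightarrow> a \<odot>\<^bsub>M\<^esub> g \<oplus>\<^bsub>M\<^esub> x \<in> lin_span R M G"

lemma span_minimal:
  assumes "\<zero>\<^bsub>M\<^esub> \<in> K" "\<And>x y. x \<in> K \<Longrightarrow> y \<in> K \<Longrightarrow> x \<oplus>\<^bsub>M\<^esub> y \<in> K"
    and "\<And>a g. a \<in> carrier R \<Longrightarrow> g \<in> G \<Longrightarrow> a \<odot>\<^bsub>M\<^esub> g \<in> K"
  shows "lin_span R M G \<subseteq> K"
proof
  fix z assume "z \<in> lin_span R M G"
  then show "z \<in> K" by induction (auto intro: assms)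
qed

lemma span_mono: "G \<subseteq> H \<Longrightarrow> lin_span R M G \<subseteq> lin_span R M H"
proof
  fix z assume GH: "G \<subseteq> H" and "z \<in> lin_span R M G"
  from this(2) show "z \<in> lin_span R M H" by induction (use GH in \<open>auto intro: lin_span.intros\<close>)
qed

context module
begin

lemma span_subset: "G \<subseteq> carrier M \<Longrightarrow> lin_span R M G \<subseteq> carrier M"
  by (rule span_minimal) auto

lemma span_add:
  assumes "G \<subseteq> carrier M" "x \<in> lin_span R M G" "y \<in> lin_span R M G"
  shows "x \<oplus>\<^bsub>M\<^esub> y \<in> lin_span R M G"
  using assms(2)
proof induction
  case (step a g x)
  have "g \<in> carrier M" "x \<in> carrier M" "y \<in> carrier M"
    using step assms span_subset[OF assms(1)] by auto
  then show ?case using step lin_span.step[OF step(1,2,4)] by (simp add: M.a_assoc)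
qed (use assms span_subset[OF assms(1)] in auto)

lemma span_smult:
  assumes "G \<subseteq> carrier M" "x \<in> lin_span R M G" "b \<in> carrier R"
  shows "b \<odot>\<^bsub>M\<^esub> x \<in> lin_span R M G"
  using assms(2)
proof induction
  case (step a g x)
  have "g \<in> carrier M" "x \<in> carrier M"
    using step assms span_subset[OF assms(1)] by auto
  moreover have "(b \<otimes> a) \<odot>\<^bsub>M\<^esub> g \<oplus>\<^bsub>M\<^esub> b \<odot>\<^bsub>M\<^esub> x \<in> lin_span R M G"
    using step assms by (intro lin_span.step) auto
  ultimately show ?case using step assms by (simp add: smult_r_distr smult_assoc1)
qed (use assms lin_span.zero in simp)

lemma span_smult_incl:
  assumes "G \<subseteq> carrier M" "g \<in> G" "a \<in> carrier R"
  shows "a \<odot>\<^bsub>M\<^esub> g \<in> lin_span R M G"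
  using lin_span.step[OF assms(3,2) lin_span.zero[of M]] assms by auto

lemma span_incl: "G \<subseteq> carrier M \<Longrightarrow> G \<subseteq> lin_span R M G"
  using span_smult_incl[of G _ "\<one>"] by (metis R.one_closed smult_one subset_iff)

lemma span_least:
  assumes "H \<subseteq> carrier M" "G \<subseteq> lin_span R M H"
  shows "lin_span R M G \<subseteq> lin_span R M H"
  by (rule span_minimal) (use assms span_add span_smult lin_span.zero in auto)

lemma span_finsum:
  assumes "G \<subseteq> carrier M" "finite A" "v \<in> A \<rightarrow> lin_span R M G"
  shows "(\<Oplus>\<^bsub>M\<^esub>i\<in>A. v i) \<in> lin_span R M G"
  using assms(2,3)
proof (induction rule: finite_induct)
  case (insert a A)
  then have "v \<in> A \<rightarrow> carrier M" "v a \<in> carrier M" using span_subset[OF assms(1)] by auto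
  then show ?case using insert span_add[OF assms(1)] by (auto simp: Pi_iff)
qed (simp add: lin_span.zero)

lemma span_diff:
  assumes "G \<subseteq> carrier M" "x \<in> lin_span R M G" "y \<in> lin_span R M G"
  shows "x \<ominus>\<^bsub>M\<^esub> y \<in> lin_span R M G"
proof -
  have "y \<in> carrier M" using assms span_subset by blast
  then have "\<ominus>\<^bsub>M\<^esub> y = (\<ominus> \<one>) \<odot>\<^bsub>M\<^esub> y" by (simp add: smult_l_minus)
  then show ?thesis unfolding a_minus_def
    using span_add[OF assms(1,2) span_smult[OF assms(1,3)]] by simp
qed

end

lemma span_finite_support:
  assumes "z \<in> lin_span R M G"
  shows "\<exists>F\<subseteq>G. finite F \<and> z \<in> lin_span R M F"
  using assms
proof induction
  case zero
  show ?case by (intro exI[of _ "{}"] conjI lin_span.zero) auto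
next
  case (step a g x)
  then obtain F where "F \<subseteq> G" "finite F" "x \<in> lin_span R M F" by blast
  moreover have "lin_span R M F \<subseteq> lin_span R M (insert g F)" by (rule span_mono) auto
  ultimately show ?case using step
    by (intro exI[of _ "insert g F"] conjI lin_span.step) auto
qed

text \<open>Each derivation in \<open>lin_span\<close> mentions finitely many generators. This later
  cuts the set of all syzygies over \<open>R\<close> down to a finite subset with enough
  span.\<close>

lemma finite_subset_span_support:
  assumes "finite Z" "Z \<subseteq> lin_span R M G"
  shows "\<exists>F\<subseteq>G. finite F \<and> Z \<subseteq> lin_span R M F"
proof -
  have "\<forall>z\<in>Z. \<exists>F. F \<subseteq> G \<and> finite F \<and> z \<in> lin_span R M F"
    using assms(2) span_finite_support by (metis subsetD)
  then obtain F where F: "\<And>z. z \<in> Z \<Longrightarrow> F z \<subseteq> G \<and> finite (F z) \<and> z \<in> lin_span R M (F z)"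
    by metis
  have "lin_span R M (F z) \<subseteq> lin_span R M (\<Union>z\<in>Z. F z)" if "z \<in> Z" for z
    by (rule span_mono) (use that in blast)
  then show ?thesis using F assms(1) by (intro exI[of _ "\<Union>z\<in>Z. F z"]) blast
qed

lemma linear_image_span:
  assumes "module R M" "module R N" "f \<in> linear_maps R M N" "G \<subseteq> carrier M"
  shows "f ` lin_span R M G = lin_span R N (f ` G)"
proof
  interpret M: module R M by fact
  interpret N: module R N by fact
  note f = linear_mapsD[OF assms(3)]
  show "f ` lin_span R M G \<subseteq> lin_span R N (f ` G)"
  proof clarify
    fix z assume "z \<in> lin_span R M G"
    then show "f z \<in> lin_span R N (f ` G)"
    proof induction
      case zero
      then show ?case by (simp add: linear_map_zero[OF assms(1-3)] lin_span.zero)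
    next
      case (step a g x)
      then have "g \<in> carrier M" "x \<in> carrier M" using assms(4) M.span_subset[OF assms(4)] by auto
      then show ?case using step by (auto simp: f intro!: lin_span.step)
    qed
  qed
  show "lin_span R N (f ` G) \<subseteq> f ` lin_span R M G"
  proof
    fix z assume "z \<in> lin_span R N (f ` G)"
    then show "z \<in> f ` lin_span R M G"
    proof induction
      case zero
      have "f \<zero>\<^bsub>M\<^esub> \<in> f ` lin_span R M G" by (rule imageI[OF lin_span.zero])
      then show ?case by (simp add: linear_map_zero[OF assms(1-3)])
    next
      case (step a g x)
      then obtain h y where h: "h \<in> G" "g = f h" "y \<in> lin_span R M G" "x = f y" by blast
      then have "h \<in> carrier M" "y \<in> carrier M" using assms(4) M.span_subset[OF assms(4)] by auto
      then have "a \<odot>\<^bsub>N\<^esub> g \<oplus>\<^bsub>N\<^esub> x = f (a \<odot>\<^bsub>M\<^esub> h \<oplus>\<^bsub>M\<^esub> y)" using h step by (simp add: f)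
      moreover have "f (a \<odot>\<^bsub>M\<^esub> h \<oplus>\<^bsub>M\<^esub> y) \<in> f ` lin_span R M G"
        by (rule imageI[OF lin_span.step[OF step(1) h(1,3)]])
      ultimately show ?case by (simp only:)
    qed
  qed
qed

section \<open>Coordinates on \<open>R^n\<close> and maps out of it\<close>

definition lincomb :: "('a, 'm, 'q) module_scheme \<Rightarrow> nat \<Rightarrow> (nat \<Rightarrow> 'm) \<Rightarrow> (nat \<Rightarrow> 'a) \<Rightarrow> 'm"
  where "lincomb M n v r = (\<Oplus>\<^bsub>M\<^esub>i\<in>{..<n}. r i \<odot>\<^bsub>M\<^esub> v i)"

text \<open>The restriction makes the vector \<open>undefined\<close> outside \<open>{..<n}\<close>,
  as membership in the extensional carrier of \<open>free_module\<close> demands.\<close>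

definition unit_vec :: "('a, 'p) ring_scheme \<Rightarrow> nat \<Rightarrow> nat \<Rightarrow> nat \<Rightarrow> 'a"
  where "unit_vec R n i = (\<lambda>j\<in>{..<n}. if j = i then \<one>\<^bsub>R\<^esub> else \<zero>\<^bsub>R\<^esub>)"

lemma finsum_free_module:
  assumes "cring R" "finite A" "v \<in> A \<rightarrow> carrier (free_module R n)" "j < n"
  shows "(\<Oplus>\<^bsub>free_module R n\<^esub>i\<in>A. v i) j = (\<Oplus>\<^bsub>R\<^esub>i\<in>A. v i j)"
proof -
  interpret R: cring R by fact
  interpret F: module R "free_module R n" by (rule module_free_module[OF assms(1)])
  show ?thesis using assms(2,3)
  proof (induction rule: finite_induct)
    case (insert a A)
    then have "(\<lambda>i. v i j) \<in> A \<rightarrow> carrier R" "v a j \<in> carrier R"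
      using assms(4) by (auto simp: free_module_simps Pi_iff PiE_iff)
    then show ?case using insert assms(4) by (simp add: free_module_simps(3))
  qed (simp add: free_module_simps assms(4))
qed

context module
begin

lemma lincomb_cong:
  assumes "r \<in> carrier (free_module R n)" "\<And>i. i < n \<Longrightarrow> v i = w i" "w \<in> {..<n} \<rightarrow> carrier M"
  shows "lincomb M n v r = lincomb M n w r"
  unfolding lincomb_def using assms
  by (intro M.finsum_cong') (auto simp: free_module_simps Pi_iff PiE_iff)

lemma lincomb_linear:
  assumes "v \<in> {..<n} \<rightarrow> carrier M"
  shows "lincomb M n v \<in> linear_maps R (free_module R n) M"
proof -
  have c: "r i \<in> carrier R" "v i \<in> carrier M" if "r \<in> {..<n} \<rightarrow>\<^sub>E carrier R" "i < n" for r i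
    using that assms by (auto simp: Pi_iff PiE_iff)
  have s: "(\<lambda>i. r i \<odot>\<^bsub>M\<^esub> v i) \<in> {..<n} \<rightarrow> carrier M" if "r \<in> {..<n} \<rightarrow>\<^sub>E carrier R" for r
    using c[OF that] by auto
  show ?thesis
    unfolding linear_maps_def lincomb_def
  proof (intro CollectI conjI ballI funcsetI)
    fix r assume "r \<in> carrier (free_module R n)"
    then have r: "r \<in> {..<n} \<rightarrow>\<^sub>E carrier R" by (simp add: free_module_simps)
    show "(\<Oplus>\<^bsub>M\<^esub>i\<in>{..<n}. r i \<odot>\<^bsub>M\<^esub> v i) \<in> carrier M"
      by (rule M.finsum_closed[OF s[OF r]])
  next
    fix r r' assume "r \<in> carrier (free_module R n)" "r' \<in> carrier (free_module R n)"
    then have r: "r \<in> {..<n} \<rightarrow>\<^sub>E carrier R" "r' \<in> {..<n} \<rightarrow>\<^sub>E carrier R"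
      by (simp_all add: free_module_simps)
    show "(\<Oplus>\<^bsub>M\<^esub>i\<in>{..<n}. (r \<oplus>\<^bsub>free_module R n\<^esub> r') i \<odot>\<^bsub>M\<^esub> v i)
        = (\<Oplus>\<^bsub>M\<^esub>i\<in>{..<n}. r i \<odot>\<^bsub>M\<^esub> v i) \<oplus>\<^bsub>M\<^esub> (\<Oplus>\<^bsub>M\<^esub>i\<in>{..<n}. r' i \<odot>\<^bsub>M\<^esub> v i)"
      unfolding M.finsum_addf[OF s[OF r(1)] s[OF r(2)], symmetric]
      using c[OF r(1)] c[OF r(2)]
      by (intro M.finsum_cong') (auto simp: free_module_simps smult_l_distr)
  next
    fix a r assume a: "a \<in> carrier R" and "r \<in> carrier (free_module R n)"
    then have r: "r \<in> {..<n} \<rightarrow>\<^sub>E carrier R" by (simp add: free_module_simps)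
    show "(\<Oplus>\<^bsub>M\<^esub>i\<in>{..<n}. (a \<odot>\<^bsub>free_module R n\<^esub> r) i \<odot>\<^bsub>M\<^esub> v i)
        = a \<odot>\<^bsub>M\<^esub> (\<Oplus>\<^bsub>M\<^esub>i\<in>{..<n}. r i \<odot>\<^bsub>M\<^esub> v i)"
      unfolding finsum_smult_ldistr[OF finite_lessThan a s[OF r]]
      using c[OF r] a
      by (intro M.finsum_cong') (auto simp: free_module_simps smult_assoc1)
  qed
qed

lemma unit_vec_closed: "unit_vec R n i \<in> carrier (free_module R n)"
  by (auto simp: unit_vec_def free_module_simps)

lemma lincomb_unit_vec:
  assumes "r \<in> carrier (free_module R n)"
  shows "lincomb (free_module R n) n (unit_vec R n) r = r"
proof -
  interpret F: module R "free_module R n" by (rule module_free_module[OF R.is_cring])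
  have r: "r i \<in> carrier R" if "i < n" for i
    using assms that by (auto simp: free_module_simps)
  have L: "lincomb (free_module R n) n (unit_vec R n) r \<in> carrier (free_module R n)"
    using linear_mapsD(1)[OF F.lincomb_linear[of "unit_vec R n" n] assms] unit_vec_closed by auto
  have m: "(\<lambda>i. r i \<odot>\<^bsub>free_module R n\<^esub> unit_vec R n i) \<in> {..<n} \<rightarrow> carrier (free_module R n)"
    using F.smult_closed[OF _ unit_vec_closed] r by simp
  have "lincomb (free_module R n) n (unit_vec R n) r j = r j" if "j < n" for j
  proof -
    have "lincomb (free_module R n) n (unit_vec R n) r j
        = (\<Oplus>\<^bsub>R\<^esub>i\<in>{..<n}. (r i \<odot>\<^bsub>free_module R n\<^esub> unit_vec R n i) j)"
      unfolding lincomb_def by (rule finsum_free_module[OF R.is_cring _ m that]) simp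
    also have "\<dots> = (\<Oplus>\<^bsub>R\<^esub>i\<in>{..<n}. if j = i then r i else \<zero>)"
      using that r by (intro R.finsum_cong') (auto simp: free_module_simps unit_vec_def)
    also have "\<dots> = r j"
      using R.finsum_singleton[of j "{..<n}" r] that r by auto
    finally show ?thesis .
  qed
  then show ?thesis
    using L assms by (auto simp: free_module_simps intro: PiE_ext)
qed

text \<open>Linearity passes through the expansion of \<open>r\<close> in unit vectors. Maps on
  \<open>R^n\<close> can thus be compared on unit vectors alone.\<close>

lemma linear_eq_lincomb:
  assumes f: "f \<in> linear_maps R (free_module R n) M" and r: "r \<in> carrier (free_module R n)"
  shows "f r = lincomb M n (\<lambda>i. f (unit_vec R n i)) r"
proof -
  interpret F: module R "free_module R n" by (rule module_free_module[OF R.is_cring])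
  have c: "r i \<in> carrier R" if "i < n" for i
    using r that by (auto simp: free_module_simps)
  have "f r = f (lincomb (free_module R n) n (unit_vec R n) r)"
    by (simp add: lincomb_unit_vec r)
  also have "\<dots> = (\<Oplus>\<^bsub>M\<^esub>i\<in>{..<n}. f (r i \<odot>\<^bsub>free_module R n\<^esub> unit_vec R n i))"
    unfolding lincomb_def
    by (rule linear_map_finsum[OF F.module_axioms module_axioms f])
      (use F.smult_closed[OF _ unit_vec_closed] c in auto)
  also have "\<dots> = lincomb M n (\<lambda>i. f (unit_vec R n i)) r"
    unfolding lincomb_def
    using linear_mapsD[OF f] unit_vec_closed c by (intro M.finsum_cong') auto
  finally show ?thesis .
qed

lemma lincomb_unit:
  assumes "v \<in> {..<n} \<rightarrow> carrier M" "i < n"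
  shows "lincomb M n v (unit_vec R n i) = v i"
proof -
  have "lincomb M n v (unit_vec R n i) = (\<Oplus>\<^bsub>M\<^esub>j\<in>{..<n}. if i = j then v j else \<zero>\<^bsub>M\<^esub>)"
    unfolding lincomb_def
    using assms by (intro M.finsum_cong') (auto simp: unit_vec_def Pi_iff)
  then show ?thesis using assms by (simp add: M.finsum_singleton)
qed

lemma free_module_span:
  "carrier (free_module R n) = lin_span R (free_module R n) (unit_vec R n ` {..<n})"
proof
  interpret F: module R "free_module R n" by (rule module_free_module[OF R.is_cring])
  have u: "unit_vec R n ` {..<n} \<subseteq> carrier (free_module R n)" using unit_vec_closed by auto
  show "lin_span R (free_module R n) (unit_vec R n ` {..<n}) \<subseteq> carrier (free_module R n)"
    by (rule F.span_subset[OF u])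
  show "carrier (free_module R n) \<subseteq> lin_span R (free_module R n) (unit_vec R n ` {..<n})"
  proof
    fix r assume r: "r \<in> carrier (free_module R n)"
    have "lincomb (free_module R n) n (unit_vec R n) r \<in> lin_span R (free_module R n) (unit_vec R n ` {..<n})"
      unfolding lincomb_def
      by (rule F.span_finsum[OF u])
        (use r F.span_smult_incl[OF u] in \<open>auto simp: free_module_simps\<close>)
    then show "r \<in> lin_span R (free_module R n) (unit_vec R n ` {..<n})"
      by (simp add: lincomb_unit_vec r)
  qed
qed

lemma linear_image_free_module:
  assumes "f \<in> linear_maps R (free_module R n) M"
  shows "f ` carrier (free_module R n) = lin_span R M ((\<lambda>i. f (unit_vec R n i)) ` {..<n})"
proof -
  have "f ` lin_span R (free_module R n) (unit_vec R n ` {..<n}) = lin_span R M (f ` unit_vec R n ` {..<n})"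
    using unit_vec_closed
    by (intro linear_image_span[OF module_free_module[OF R.is_cring] module_axioms assms]) auto
  then show ?thesis by (simp add: free_module_span[symmetric] image_image)
qed

lemma lincomb_image:
  assumes "v \<in> {..<n} \<rightarrow> carrier M"
  shows "lincomb M n v ` carrier (free_module R n) = lin_span R M (v ` {..<n})"
proof -
  have "(\<lambda>i. lincomb M n v (unit_vec R n i)) ` {..<n} = v ` {..<n}"
    using lincomb_unit[OF assms] by (intro image_cong) auto
  then show ?thesis using linear_image_free_module[OF lincomb_linear[OF assms]] by simp
qed

lemma finite_span_eq_image:
  assumes "finite G" "G \<subseteq> carrier M"
  shows "\<exists>m. \<exists>f\<in>linear_maps R (free_module R m) M. f ` carrier (free_module R m) = lin_span R M G"
proof -
  obtain m and v :: "nat \<Rightarrow> _" where v: "G = v ` {..<m}"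
    using assms(1) finite_imp_nat_seg_image_inj_on[of G] by (auto simp: lessThan_def)
  then show ?thesis
    using lincomb_linear[of v m] lincomb_image[of v m] assms(2) by blast
qed

text \<open>Projectivity of \<open>R^n\<close>: preimages under \<open>f\<close> of the images of
  the unit vectors are chosen, and the lift is the linear combination of them.\<close>

lemma lift_free_module:
  assumes N: "module R N" and f: "f \<in> linear_maps R N M" "f ` carrier N = carrier M"
    and g: "g \<in> linear_maps R (free_module R n) M"
  shows "\<exists>h\<in>linear_maps R (free_module R n) N. \<forall>r\<in>carrier (free_module R n). f (h r) = g r"
proof -
  interpret N: module R N by fact
  have "\<forall>i. \<exists>w. w \<in> carrier N \<and> f w = g (unit_vec R n i)"
    using f(2) linear_mapsD(1)[OF g unit_vec_closed] by (metis imageE)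
  then obtain w where w: "\<And>i. w i \<in> carrier N" "\<And>i. f (w i) = g (unit_vec R n i)" by metis
  have h: "lincomb N n w \<in> linear_maps R (free_module R n) N"
    using w by (intro N.lincomb_linear) auto
  have "f (lincomb N n w r) = g r" if r: "r \<in> carrier (free_module R n)" for r
  proof -
    have "f (lincomb N n w r) = lincomb M n (\<lambda>i. f (lincomb N n w (unit_vec R n i))) r"
      by (rule linear_eq_lincomb[OF linear_map_comp[OF h f(1)] r])
    also have "\<dots> = lincomb M n (\<lambda>i. g (unit_vec R n i)) r"
      using w N.lincomb_unit[of w n] r linear_mapsD(1)[OF g unit_vec_closed]
      by (intro lincomb_cong) auto
    also have "\<dots> = g r" by (rule linear_eq_lincomb[OF g r, symmetric])
    finally show ?thesis .
  qed
  then show ?thesis using h by blast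
qed

end

section \<open>Finite presentation does not depend on the generators\<close>

lemma linear_map_minus:
  assumes "module R M" "module R N" "f \<in> linear_maps R M N" "g \<in> linear_maps R M N"
  shows "(\<lambda>x. f x \<ominus>\<^bsub>N\<^esub> g x) \<in> linear_maps R M N"
proof -
  interpret N: module R N by fact
  note f = linear_mapsD[OF assms(3)] and g = linear_mapsD[OF assms(4)]
  show ?thesis
    unfolding linear_maps_def
  proof (intro CollectI conjI ballI funcsetI)
    fix x y assume "x \<in> carrier M" "y \<in> carrier M"
    then show "f (x \<oplus>\<^bsub>M\<^esub> y) \<ominus>\<^bsub>N\<^esub> g (x \<oplus>\<^bsub>M\<^esub> y) = (f x \<ominus>\<^bsub>N\<^esub> g x) \<oplus>\<^bsub>N\<^esub> (f y \<ominus>\<^bsub>N\<^esub> g y)"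
      using f(1,2) g(1,2) by (simp add: a_minus_def N.minus_add N.M.a_ac)
  qed (use f g in \<open>auto simp: a_minus_def N.smult_r_distr N.smult_r_minus\<close>)
qed

definition relations ::
    "('a, 'p) ring_scheme \<Rightarrow> ('a, 'm, 'q) module_scheme \<Rightarrow> nat \<Rightarrow> (nat \<Rightarrow> 'm) \<Rightarrow> (nat \<Rightarrow> 'a) set"
  where "relations R M n v = {r \<in> carrier (free_module R n). lincomb M n v r = \<zero>\<^bsub>M\<^esub>}"

text \<open>Only one inclusion is required; when \<open>K\<close> is a submodule, as for kernels and
  syzygies, \<open>G\<close> inside \<open>K\<close> gives the other.\<close>

definition finitely_spanned ::
    "('a, 'p) ring_scheme \<Rightarrow> ('a, 'm, 'q) module_scheme \<Rightarrow> 'm set \<Rightarrow> bool"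
  where "finitely_spanned R M K \<longleftrightarrow> (\<exists>G\<subseteq>K. finite G \<and> K \<subseteq> lin_span R M G)"

lemma (in module) span_kernel:
  assumes "module R N" "f \<in> linear_maps R N M" "G \<subseteq> {x \<in> carrier N. f x = \<zero>\<^bsub>M\<^esub>}"
  shows "lin_span R N G \<subseteq> {x \<in> carrier N. f x = \<zero>\<^bsub>M\<^esub>}"
proof -
  interpret N: module R N by fact
  show ?thesis
    by (rule span_minimal)
      (use assms(3) in \<open>auto simp: linear_map_zero[OF assms(1) module_axioms assms(2)]
        linear_mapsD[OF assms(2)]\<close>)
qed

text \<open>
  Which finite generating family is used does not matter: two presentations are compared by lifting
  each generating map through the other, as in Schanuel's lemma.
\<close>

lemma (in module) finitely_presented_iff_relations:
  assumes v: "v \<in> {..<n} \<rightarrow> carrier M" "lin_span R M (v ` {..<n}) = carrier M"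
  shows "finitely_presented R M \<longleftrightarrow>
    finitely_spanned R (free_module R n) (relations R M n v)"
proof
  interpret F: module R "free_module R n" by (rule module_free_module[OF R.is_cring])
  let ?g = "lincomb M n v"
  have g: "?g \<in> linear_maps R (free_module R n) M" by (rule lincomb_linear[OF v(1)])
  have gs: "?g ` carrier (free_module R n) = carrier M" using lincomb_image[OF v(1)] v(2) by simp
  show "finitely_presented R M" if fs: "finitely_spanned R (free_module R n) (relations R M n v)"
  proof -
    from fs obtain G where G: "G \<subseteq> relations R M n v" "finite G"
      "relations R M n v \<subseteq> lin_span R (free_module R n) G"
      unfolding finitely_spanned_def by (elim exE conjE)
    have "lin_span R (free_module R n) G \<subseteq> relations R M n v"
      unfolding relations_def
      by (rule span_kernel[OF F.module_axioms g G(1)[unfolded relations_def]])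
    then have eq: "lin_span R (free_module R n) G = relations R M n v"
      using G(3) by (rule antisym)
    have "G \<subseteq> carrier (free_module R n)" using G(1) unfolding relations_def by blast
    from F.finite_span_eq_image[OF G(2) this, unfolded eq relations_def]
    obtain m f where f: "f \<in> linear_maps R (free_module R m) (free_module R n)"
      "f ` carrier (free_module R m) =
        {r \<in> carrier (free_module R n). lincomb M n v r = \<zero>\<^bsub>M\<^esub>}"
      by (elim exE bexE) (rule that)
    show ?thesis
      unfolding finitely_presented_def
      by (intro conjI exI[of _ m] exI[of _ n] bexI[OF _ f(1)] bexI[OF _ g] module_axioms gs f(2))
  qed
  show "finitely_spanned R (free_module R n) (relations R M n v)" if fp: "finitely_presented R M"
  proof -
    obtain m p f q where f: "f \<in> linear_maps R (free_module R m) (free_module R p)"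
      and q: "q \<in> linear_maps R (free_module R p) M"
      and fq: "f ` carrier (free_module R m) = {x \<in> carrier (free_module R p). q x = \<zero>\<^bsub>M\<^esub>}"
      and qs: "q ` carrier (free_module R p) = carrier M"
      using fp unfolding finitely_presented_def by blast
    interpret Fp: module R "free_module R p" by (rule module_free_module[OF R.is_cring])
    interpret Fm: module R "free_module R m" by (rule module_free_module[OF R.is_cring])
    obtain d where d: "d \<in> linear_maps R (free_module R n) (free_module R p)"
      and qd: "\<And>r. r \<in> carrier (free_module R n) \<Longrightarrow> q (d r) = ?g r"
      using lift_free_module[OF Fp.module_axioms q qs g] by blast
    obtain h where h: "h \<in> linear_maps R (free_module R p) (free_module R n)"
      and gh: "\<And>r. r \<in> carrier (free_module R p) \<Longrightarrow> ?g (h r) = q r"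
      using lift_free_module[OF F.module_axioms g gs q] by blast
    \<comment> \<open>The two lifts satisfy \<open>q d = g\<close> and \<open>g h = q\<close>, so
      \<open>g h d = g\<close> and the difference of the identity and \<open>h d\<close> takes its
      values in the kernel of \<open>g\<close>.\<close>
    define k where "k r = r \<ominus>\<^bsub>free_module R n\<^esub> h (d r)" for r
    have id: "(\<lambda>r. r) \<in> linear_maps R (free_module R n) (free_module R n)"
      by (auto simp: linear_maps_def)
    have k: "k \<in> linear_maps R (free_module R n) (free_module R n)"
      unfolding k_def
      by (rule linear_map_minus[OF F.module_axioms F.module_axioms id linear_map_comp[OF d h]])
    have hf: "(\<lambda>s. h (f s)) \<in> linear_maps R (free_module R m) (free_module R n)"
      by (rule linear_map_comp[OF f h])
    \<comment> \<open>If \<open>g r\<close> is zero then \<open>q (d r)\<close> is zero, so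
      \<open>d r\<close> lies in the image of \<open>f\<close>. Hence in
      \<open>r = k r + h (d r)\<close> the first term comes from the images of the unit vectors
      under \<open>k\<close>, the second from those under \<open>h f\<close>.\<close>
    define G where "G = (\<lambda>i. k (unit_vec R n i)) ` {..<n} \<union> (\<lambda>i. h (f (unit_vec R m i))) ` {..<m}"
    have kr: "k r \<in> relations R M n v" if r: "r \<in> carrier (free_module R n)" for r
    proof -
      have hd: "h (d r) \<in> carrier (free_module R n)" "d r \<in> carrier (free_module R p)"
        using linear_mapsD(1)[OF linear_map_comp[OF d h] r] linear_mapsD(1)[OF d r] by auto
      have "?g (k r) = ?g r \<ominus>\<^bsub>M\<^esub> ?g (h (d r))"
        unfolding k_def by (rule linear_map_diff[OF F.module_axioms module_axioms g r hd(1)])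
      also have "?g (h (d r)) = ?g r" using gh[OF hd(2)] qd[OF r] by (rule trans)
      also have "?g r \<ominus>\<^bsub>M\<^esub> ?g r = \<zero>\<^bsub>M\<^esub>"
        using linear_mapsD(1)[OF g r] by (simp only: a_minus_def M.r_neg)
      finally show ?thesis using linear_mapsD(1)[OF k r] unfolding relations_def by blast
    qed
    have hfr: "h (f s) \<in> relations R M n v" if "s \<in> carrier (free_module R m)" for s
    proof -
      have "f s \<in> {x \<in> carrier (free_module R p). q x = \<zero>\<^bsub>M\<^esub>}" using fq that by blast
      then show ?thesis
        using linear_mapsD(1)[OF hf that] gh[of "f s"] unfolding relations_def by simp
    qed
    have Gr: "G \<subseteq> relations R M n v"
      unfolding G_def using kr[OF unit_vec_closed] hfr[OF unit_vec_closed] by blast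
    then have Gc: "G \<subseteq> carrier (free_module R n)" unfolding relations_def by blast
    have Gf: "finite G" by (simp add: G_def)
    have "r \<in> lin_span R (free_module R n) G" if r: "r \<in> relations R M n v" for r
    proof -
      have rc: "r \<in> carrier (free_module R n)" using r by (simp add: relations_def)
      have "k r \<in> lin_span R (free_module R n) G"
      proof -
        have "k r \<in> lin_span R (free_module R n) ((\<lambda>i. k (unit_vec R n i)) ` {..<n})"
          unfolding F.linear_image_free_module[OF k, symmetric] using rc by (rule imageI)
        then show ?thesis by (rule subsetD[OF span_mono, rotated]) (simp add: G_def)
      qed
      moreover have "h (d r) \<in> lin_span R (free_module R n) G"
      proof -
        have "q (d r) = \<zero>\<^bsub>M\<^esub>" using r qd[OF rc] by (simp add: relations_def)
        then have "d r \<in> f ` carrier (free_module R m)"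
          unfolding fq using linear_mapsD(1)[OF d rc] by simp
        then have "h (d r) \<in> (\<lambda>s. h (f s)) ` carrier (free_module R m)" by auto
        then have "h (d r) \<in> lin_span R (free_module R n) ((\<lambda>i. h (f (unit_vec R m i))) ` {..<m})"
          unfolding F.linear_image_free_module[OF hf] .
        then show ?thesis by (rule subsetD[OF span_mono, rotated]) (simp add: G_def)
      qed
      moreover have "k r \<oplus>\<^bsub>free_module R n\<^esub> h (d r) = r"
        unfolding k_def a_minus_def using rc linear_mapsD(1)[OF linear_map_comp[OF d h] rc]
        by (simp add: F.M.a_assoc F.M.l_neg)
      ultimately show ?thesis using F.span_add[OF Gc, of "k r" "h (d r)"] by simp
    qed
    then show ?thesis
      unfolding finitely_spanned_def using Gr Gf by blast
  qed
qed

section \<open>Syzygies and coherent rings\<close>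

text \<open>The sum is that of \<open>S\<close> itself and not of some
  \<open>mult_module S I\<close>, whose \<open>finsum\<close> depends on \<open>I\<close>. Syzygies
  then belong to the family alone, and families in a subring can be compared with the same families
  in the ring.\<close>

definition ring_comb :: "('a, 'p) ring_scheme \<Rightarrow> nat \<Rightarrow> (nat \<Rightarrow> 'a) \<Rightarrow> (nat \<Rightarrow> 'a) \<Rightarrow> 'a"
  where "ring_comb S n x r = (\<Oplus>\<^bsub>S\<^esub>i\<in>{..<n}. r i \<otimes>\<^bsub>S\<^esub> x i)"

definition syzygies :: "('a, 'p) ring_scheme \<Rightarrow> nat \<Rightarrow> (nat \<Rightarrow> 'a) \<Rightarrow> (nat \<Rightarrow> 'a) set"
  where "syzygies S n x = {r \<in> carrier (free_module S n). ring_comb S n x r = \<zero>\<^bsub>S\<^esub>}"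

text \<open>\<open>X\<close> and \<open>Y\<close> change only the carrier, which the rules of
  \<open>lin_span\<close> never consult.\<close>

lemma lin_span_mult_module:
  "lin_span S (mult_module S X) G = lin_span S (mult_module S Y) G"
proof -
  have "lin_span S (mult_module S X) G \<subseteq> lin_span S (mult_module S Y) G" for X Y
  proof
    fix z assume "z \<in> lin_span S (mult_module S X) G"
    then show "z \<in> lin_span S (mult_module S Y) G"
      using lin_span.zero[of "mult_module S Y" S G] lin_span.step[of _ S _ G _ "mult_module S Y"]
      by induction (auto simp: mult_module_simps)
  qed
  then show ?thesis by blast
qed

context cring
begin

lemma module_mult_module_self: "module R (mult_module R (carrier R))"
  by (rule module_mult_module_ideal[OF is_cring oneideal])

lemma lincomb_mult_module:
  assumes "ideal I R" "x \<in> {..<n} \<rightarrow> I" "r \<in> carrier (free_module R n)"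
  shows "lincomb (mult_module R I) n x r = ring_comb R n x r"
proof -
  interpret I: ideal I R by fact
  interpret M: module R "mult_module R I" by (rule module_mult_module_ideal[OF is_cring assms(1)])
  have "(\<lambda>i. r i \<otimes> x i) \<in> {..<n} \<rightarrow> I"
    using assms(2,3) I.I_l_closed by (auto simp: free_module_simps)
  then show ?thesis
    unfolding lincomb_def ring_comb_def mult_module_simps
    using I.a_subset
    by (intro finsum_carrier_mono[OF M.M.abelian_monoid_axioms abelian_monoid_axioms])
      (auto simp: mult_module_simps)
qed

text \<open>The kernel of the presentation map is the same for every ideal containing the family,
  because sums in the ideal are sums in the ring.\<close>

lemma relations_mult_module:
  assumes "ideal I R" "x \<in> {..<n} \<rightarrow> I"
  shows "relations R (mult_module R I) n x = syzygies R n x"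
  using lincomb_mult_module[OF assms] by (auto simp: relations_def syzygies_def mult_module_simps)

lemma ring_comb_linear:
  assumes "x \<in> {..<n} \<rightarrow> carrier R"
  shows "ring_comb R n x \<in> linear_maps R (free_module R n) (mult_module R (carrier R))"
proof -
  interpret M: module R "mult_module R (carrier R)" by (rule module_mult_module_self)
  interpret F: module R "free_module R n" by (rule module_free_module[OF is_cring])
  have "lincomb (mult_module R (carrier R)) n x \<in>
      linear_maps R (free_module R n) (mult_module R (carrier R))"
    using assms by (intro M.lincomb_linear) (simp add: mult_module_simps)
  then show ?thesis
    unfolding linear_maps_def
    by (auto simp: lincomb_mult_module[OF oneideal assms, symmetric] Pi_iff)
qed

text \<open>The span is already an ideal: closure under negation comes from the scalar minus one,
  two-sidedness from commutativity. Minimality of the generated ideal gives one inclusion and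
  minimality of the span the other.\<close>

lemma genideal_eq_span:
  assumes "X \<subseteq> carrier R"
  shows "Idl X = lin_span R (mult_module R (carrier R)) X"
proof
  interpret M: module R "mult_module R (carrier R)" by (rule module_mult_module_self)
  have X: "X \<subseteq> carrier (mult_module R (carrier R))" using assms by (simp add: mult_module_simps)
  let ?J = "lin_span R (mult_module R (carrier R)) X"
  have sub: "?J \<subseteq> carrier R" using M.span_subset[OF X] by (simp add: mult_module_simps)
  have sm: "a \<otimes> y \<in> ?J" if "a \<in> carrier R" "y \<in> ?J" for a y
    using M.span_smult[OF X that(2,1)] by (simp add: mult_module_simps)
  have sm': "y \<otimes> a \<in> ?J" if "a \<in> carrier R" "y \<in> ?J" for a y
    using sm[OF that] m_comm that sub by auto
  have neg: "\<ominus> y \<in> ?J" if "y \<in> ?J" for y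
    using sm[of "\<ominus> \<one>" y] that sub by (auto simp: l_minus)
  have "ideal ?J R"
  proof (rule idealI)
    show "subgroup ?J (add_monoid R)"
    proof (rule add.subgroupI)
      show "?J \<noteq> {}" using lin_span.zero[of "mult_module R (carrier R)"] by blast
    qed (use sub neg M.span_add[OF X] in \<open>auto simp: mult_module_simps a_inv_def[symmetric]\<close>)
  qed (use sm sm' in \<open>auto simp: ring_axioms\<close>)
  then show "Idl X \<subseteq> ?J"
    using M.span_incl[OF X] by (intro genideal_minimal)
  have "ideal (Idl X) R" by (rule genideal_ideal[OF assms])
  then interpret J: ideal "Idl X" R .
  show "?J \<subseteq> Idl X"
    by (rule span_minimal)
      (use genideal_self[OF assms] in \<open>auto simp: mult_module_simps J.I_l_closed\<close>)
qed

lemma genideal_eq_ring_comb: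
  assumes "x \<in> {..<n} \<rightarrow> carrier R"
  shows "Idl (x ` {..<n}) = ring_comb R n x ` carrier (free_module R n)"
proof -
  interpret M: module R "mult_module R (carrier R)" by (rule module_mult_module_self)
  have "lincomb (mult_module R (carrier R)) n x ` carrier (free_module R n)
      = lin_span R (mult_module R (carrier R)) (x ` {..<n})"
    using assms by (intro M.lincomb_image) (simp add: mult_module_simps)
  moreover have "x ` {..<n} \<subseteq> carrier R" using assms by auto
  moreover have "lincomb (mult_module R (carrier R)) n x ` carrier (free_module R n)
      = ring_comb R n x ` carrier (free_module R n)"
    by (rule image_cong[OF refl lincomb_mult_module[OF oneideal assms]])
  ultimately show ?thesis by (simp add: genideal_eq_span)
qed

lemma fg_idealI:
  fixes x :: "nat \<Rightarrow> 'a"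
  assumes "x \<in> {..<n} \<rightarrow> carrier R"
  shows "fg_ideal (Idl (x ` {..<n})) R"
proof -
  have "x ` {..<n} \<subseteq> carrier R" using assms by auto
  then show ?thesis
    unfolding fg_ideal_def using genideal_ideal by (auto intro!: exI[of _ "x ` {..<n}"])
qed

lemma fg_idealE:
  assumes "fg_ideal I R"
  obtains n and x :: "nat \<Rightarrow> 'a" where "x \<in> {..<n} \<rightarrow> carrier R" "I = Idl (x ` {..<n})"
proof -
  obtain S where S: "S \<subseteq> carrier R" "finite S" "I = Idl S"
    using assms unfolding fg_ideal_def by blast
  from finite_imp_nat_seg_image_inj_on[OF S(2)]
  obtain n and x :: "nat \<Rightarrow> _" where x: "S = x ` {i. i < n}" by (elim exE conjE) (rule that)
  show thesis
    by (rule that[of x n]) (use S x in \<open>auto simp: lessThan_def\<close>)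
qed

lemma finitely_presented_genideal_iff:
  assumes "x \<in> {..<n} \<rightarrow> carrier R"
  shows "finitely_presented R (mult_module R (Idl (x ` {..<n}))) \<longleftrightarrow>
    finitely_spanned R (free_module R n) (syzygies R n x)"
proof -
  have x: "x ` {..<n} \<subseteq> carrier R" using assms by auto
  have I: "ideal (Idl (x ` {..<n})) R" by (rule genideal_ideal[OF x])
  have xI: "x \<in> {..<n} \<rightarrow> Idl (x ` {..<n})" using genideal_self[OF x] by auto
  interpret M: module R "mult_module R (Idl (x ` {..<n}))"
    by (rule module_mult_module_ideal[OF is_cring I])
  have "lin_span R (mult_module R (Idl (x ` {..<n}))) (x ` {..<n}) = Idl (x ` {..<n})"
    by (rule trans[OF lin_span_mult_module genideal_eq_span[OF x, symmetric]])
  then show ?thesis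
    using M.finitely_presented_iff_relations[of x n, unfolded mult_module_simps, OF xI]
    unfolding relations_mult_module[OF I xI] by blast
qed

text \<open>The form in which coherence is used throughout: it speaks of families instead of ideals,
  and a family can be read in a larger ring, reduced modulo \<open>C\<close>, or multiplied by
  \<open>c\<close>. Every finitely generated ideal is enumerated by some family, and finite
  presentation may be tested on that family.\<close>

lemma coherent_ring_iff_syzygies:
  "coherent_ring R \<longleftrightarrow>
    (\<forall>n x. x \<in> {..<n} \<rightarrow> carrier R \<longrightarrow> finitely_spanned R (free_module R n) (syzygies R n x))"
proof (intro iffI allI impI)
  fix n and x :: "nat \<Rightarrow> 'a" assume R: "coherent_ring R" and x: "x \<in> {..<n::nat} \<rightarrow> carrier R"
  have "finitely_presented R (mult_module R (Idl (x ` {..<n})))"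
    using R fg_idealI[OF x] unfolding coherent_ring_def by simp
  then show "finitely_spanned R (free_module R n) (syzygies R n x)"
    unfolding finitely_presented_genideal_iff[OF x] .
next
  assume *: "\<forall>n x. x \<in> {..<n} \<rightarrow> carrier R \<longrightarrow>
    finitely_spanned R (free_module R n) (syzygies R n x)"
  have "finitely_presented R (mult_module R I)" if I: "fg_ideal I R" for I
  proof -
    obtain n and x :: "nat \<Rightarrow> 'a" where x: "x \<in> {..<n} \<rightarrow> carrier R" "I = Idl (x ` {..<n})"
      using fg_idealE[OF I] .
    show ?thesis
      unfolding x(2) finitely_presented_genideal_iff[OF x(1)] using * x(1) by simp
  qed
  then show "coherent_ring R" unfolding coherent_ring_def using is_cring by simp
qed

end

section \<open>Tensor products and flatness\<close>

lemma tensor_relators_subset: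
  assumes "module R M" "module R N"
  shows "tensor_relators R M N \<subseteq> carrier (free_Abelian_group (carrier M \<times> carrier N))"
proof -
  interpret M: module R M by fact
  interpret N: module R N by fact
  show ?thesis
    unfolding tensor_relators_def
    by (auto dest!: subsetD[OF keys_diff] simp: keys_frag_of)
qed

lemma tensor_null_subgroup:
  assumes "module R M" "module R N"
  shows "subgroup (tensor_null R M N) (free_Abelian_group (carrier M \<times> carrier N))"
  unfolding tensor_null_def
  by (rule group.generate_is_subgroup[OF _ tensor_relators_subset[OF assms]]) simp

lemma tensor_null_relator: "z \<in> tensor_relators R M N \<Longrightarrow> z \<in> tensor_null R M N"
  unfolding tensor_null_def by (rule generate.incl)

lemma tensor_null_zero: "0 \<in> tensor_null R M N"
  unfolding tensor_null_def by (metis generate.one one_free_Abelian_group)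

lemma tensor_null_add:
  "z \<in> tensor_null R M N \<Longrightarrow> w \<in> tensor_null R M N \<Longrightarrow> z + w \<in> tensor_null R M N"
  unfolding tensor_null_def
  using generate.eng[of z "free_Abelian_group (carrier M \<times> carrier N)"] by fastforce

lemma tensor_null_uminus:
  assumes "module R M" "module R N" "z \<in> tensor_null R M N"
  shows "- z \<in> tensor_null R M N"
proof -
  have s: "subgroup (tensor_null R M N) (free_Abelian_group (carrier M \<times> carrier N))"
    by (rule tensor_null_subgroup[OF assms(1,2)])
  then show ?thesis
    using subgroup.m_inv_closed[OF s assms(3)] subgroup.mem_carrier[OF s assms(3)] by simp
qed

lemma tensor_null_diff:
  assumes "module R M" "module R N" "z \<in> tensor_null R M N" "w \<in> tensor_null R M N"
  shows "z - w \<in> tensor_null R M N"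
  using tensor_null_add[OF assms(3) tensor_null_uminus[OF assms(1,2,4)]] by simp

lemma tensor_null_smult:
  "a \<in> carrier R \<Longrightarrow> x \<in> carrier M \<Longrightarrow> y \<in> carrier N \<Longrightarrow>
    frag_of (a \<odot>\<^bsub>M\<^esub> x, y) - frag_of (x, a \<odot>\<^bsub>N\<^esub> y) \<in> tensor_null R M N"
  by (rule tensor_null_relator) (auto simp: tensor_relators_def)

lemma tensor_null_add_right:
  "x \<in> carrier M \<Longrightarrow> y \<in> carrier N \<Longrightarrow> y' \<in> carrier N \<Longrightarrow>
    frag_of (x, y \<oplus>\<^bsub>N\<^esub> y') - frag_of (x, y) - frag_of (x, y') \<in> tensor_null R M N"
  by (rule tensor_null_relator) (unfold tensor_relators_def, blast)

text \<open>The additivity relator for the sum of zero with itself is minus the symbol in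
  question.\<close>

lemma tensor_null_zero_right:
  assumes "module R M" "module R N" "x \<in> carrier M"
  shows "frag_of (x, \<zero>\<^bsub>N\<^esub>) \<in> tensor_null R M N"
proof -
  interpret N: module R N by fact
  have "frag_of (x, \<zero>\<^bsub>N\<^esub>) - frag_of (x, \<zero>\<^bsub>N\<^esub>) - frag_of (x, \<zero>\<^bsub>N\<^esub>) \<in> tensor_null R M N"
    using tensor_null_add_right[of x M "\<zero>\<^bsub>N\<^esub>" N "\<zero>\<^bsub>N\<^esub>" R] assms(3) by simp
  from tensor_null_uminus[OF assms(1,2) this] show ?thesis by simp
qed

lemma tensor_null_sum_right:
  assumes "module R M" "module R N" "x \<in> carrier M" "finite A" "s \<in> A \<rightarrow> carrier N"
  shows "(\<Sum>i\<in>A. frag_of (x, s i)) - frag_of (x, \<Oplus>\<^bsub>N\<^esub>i\<in>A. s i) \<in> tensor_null R M N"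
  using assms(4,5)
proof (induction rule: finite_induct)
  interpret N: module R N by fact
  case empty
  show ?case
    using tensor_null_uminus[OF assms(1,2) tensor_null_zero_right[OF assms(1-3)]] by simp
next
  interpret N: module R N by fact
  case (insert a A)
  have s: "s \<in> A \<rightarrow> carrier N" "s a \<in> carrier N" using insert.prems by auto
  have "frag_of (x, s a \<oplus>\<^bsub>N\<^esub> (\<Oplus>\<^bsub>N\<^esub>i\<in>A. s i)) - frag_of (x, s a) - frag_of (x, \<Oplus>\<^bsub>N\<^esub>i\<in>A. s i)
      \<in> tensor_null R M N"
    using s assms(3) N.M.finsum_closed by (intro tensor_null_add_right) auto
  from tensor_null_diff[OF assms(1,2) insert.IH[OF s(1)] this] show ?case
    using insert.hyps s by (simp add: algebra_simps)
qed

lemma tensor_null_sum: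
  assumes "finite A" "\<And>i. i \<in> A \<Longrightarrow> z i \<in> tensor_null R M N"
  shows "(\<Sum>i\<in>A. z i) \<in> tensor_null R M N"
  using assms
  by (induction rule: finite_induct) (auto intro: tensor_null_zero tensor_null_add)

text \<open>Flatness in terms of representatives. Injectivity of the induced map is applied to just
  two classes, those of \<open>z\<close> and of 0, so its additivity need not be
  established.\<close>

lemma flat_tensor_nullD:
  fixes M M' :: "('a, 'a list set) module"
  assumes "flat_module R N" "module R M" "module R M'" "f \<in> linear_maps R M M'"
    and "inj_on f (carrier M)" "Poly_Mapping.keys z \<subseteq> carrier M \<times> carrier N"
    and "frag_extend (\<lambda>(x, y). frag_of (f x, y)) z \<in> tensor_null R M' N"
  shows "z \<in> tensor_null R M N"
proof -
  have N: "module R N" using assms(1) by (simp add: flat_module_def)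
  let ?G = "free_Abelian_group (carrier M \<times> carrier N)"
  let ?G' = "free_Abelian_group (carrier M' \<times> carrier N)"
  let ?cl = "\<lambda>z. tensor_null R M N #>\<^bsub>?G\<^esub> z"
  have inj: "inj_on (tensor_map R M M' N f) (carrier (tensor_product R M N))"
    using assms(1-5) unfolding flat_module_def by blast
  interpret G: group ?G by simp
  interpret G': group ?G' by simp
  note s = tensor_null_subgroup[OF assms(2) N] and s' = tensor_null_subgroup[OF assms(3) N]
  have "?cl z \<in> carrier (tensor_product R M N)" "?cl 0 \<in> carrier (tensor_product R M N)"
    using assms(6) by (auto simp: tensor_product_def FactGroup_def RCOSETS_def)
  \<comment> \<open>Both images are the subgroup \<open>tensor_null R M' N\<close> itself, since
    their representatives lie in it.\<close>
  moreover have "tensor_map R M M' N f (?cl z) = tensor_map R M M' N f (?cl 0)"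
    using G'.coset_join2[OF _ s' assms(7)] G'.coset_join2[OF _ s' tensor_null_zero]
      subgroup.mem_carrier[OF s' assms(7)]
    by (simp add: tensor_map_coset[OF assms(4,2,3) N] assms(6))
  ultimately have "?cl z = ?cl 0" using inj by (auto dest: inj_onD)
  moreover have "?cl 0 = tensor_null R M N"
    using G.coset_join2[OF _ s tensor_null_zero] by simp
  ultimately show ?thesis
    using G.coset_join1[OF _ _ s, of z] assms(6) by simp
qed

text \<open>
  A copy of an ideal inside the type \<^typ>\<open>'a list set\<close> over which the test modules of
  \<^const>\<open>flat_module\<close> range.
\<close>

definition encode :: "'a \<Rightarrow> 'a list set"
  where "encode a = {[a]}"

definition decode :: "'a list set \<Rightarrow> 'a"
  where "decode X = hd (the_elem X)"

lemma decode_encode [simp]: "decode (encode a) = a"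
  by (simp add: encode_def decode_def)

definition encoded_module :: "('a, 'p) ring_scheme \<Rightarrow> 'a set \<Rightarrow> ('a, 'a list set) module"
  where "encoded_module S I =
    \<lparr>carrier = encode ` I, monoid.mult = (\<lambda>X Y. encode (decode X \<otimes>\<^bsub>S\<^esub> decode Y)),
     one = encode \<one>\<^bsub>S\<^esub>, ring.zero = encode \<zero>\<^bsub>S\<^esub>,
     add = (\<lambda>X Y. encode (decode X \<oplus>\<^bsub>S\<^esub> decode Y)),
     smult = (\<lambda>a X. encode (a \<otimes>\<^bsub>S\<^esub> decode X))\<rparr>"

lemma encoded_module_simps:
  "carrier (encoded_module S I) = encode ` I"
  "\<zero>\<^bsub>encoded_module S I\<^esub> = encode \<zero>\<^bsub>S\<^esub>"
  "X \<oplus>\<^bsub>encoded_module S I\<^esub> Y = encode (decode X \<oplus>\<^bsub>S\<^esub> decode Y)"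
  "a \<odot>\<^bsub>encoded_module S I\<^esub> X = encode (a \<otimes>\<^bsub>S\<^esub> decode X)"
  by (simp_all add: encoded_module_def)

lemma module_encoded_module:
  assumes "cring S" "ideal I S"
  shows "module S (encoded_module S I)"
proof -
  interpret S: cring S by fact
  interpret I: ideal I S by fact
  have sub: "x \<in> carrier S" if "x \<in> I" for x using that I.a_subset by blast
  have "abelian_group (encoded_module S I)"
  proof (rule abelian_groupI)
    fix X assume "X \<in> carrier (encoded_module S I)"
    then obtain x where x: "x \<in> I" "X = encode x" by (auto simp: encoded_module_simps)
    then show "\<exists>Y\<in>carrier (encoded_module S I).
        Y \<oplus>\<^bsub>encoded_module S I\<^esub> X = \<zero>\<^bsub>encoded_module S I\<^esub>"
      by (intro bexI[of _ "encode (\<ominus>\<^bsub>S\<^esub> x)"])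
        (auto simp: encoded_module_simps sub S.l_neg I.a_inv_closed)
  qed (auto simp: encoded_module_simps sub S.a_ac I.a_closed)
  then show ?thesis
    by (intro moduleI)
      (auto simp: encoded_module_simps sub assms I.I_l_closed S.l_distr S.r_distr S.m_assoc)
qed

section \<open>Differences and sums under passage from \<open>R\<close> to \<open>T\<close>\<close>

lemma free_module_minus:
  assumes "cring S" "u \<in> carrier (free_module S n)" "v \<in> carrier (free_module S n)"
  shows "u \<ominus>\<^bsub>free_module S n\<^esub> v = (\<lambda>i\<in>{..<n}. u i \<ominus>\<^bsub>S\<^esub> v i)"
proof -
  interpret S: cring S by fact
  interpret F: module S "free_module S n" by (rule module_free_module[OF assms(1)])
  have c: "u i \<in> carrier S" "v i \<in> carrier S" if "i < n" for i
    using assms(2,3) that by (auto simp: free_module_simps)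
  have w: "(\<lambda>i\<in>{..<n}. u i \<ominus>\<^bsub>S\<^esub> v i) \<in> carrier (free_module S n)"
    using c by (auto simp: free_module_simps)
  let ?w = "\<lambda>i\<in>{..<n}. u i \<ominus>\<^bsub>S\<^esub> v i"
  have "(?w \<oplus>\<^bsub>free_module S n\<^esub> v) i = u i" for i
    using c[of i] PiE_arb[OF assms(2)[unfolded free_module_simps], of i]
    by (cases "i < n") (simp_all add: free_module_simps a_minus_def S.a_assoc S.l_neg)
  then have *: "?w \<oplus>\<^bsub>free_module S n\<^esub> v = u" by (rule ext)
  have "u \<ominus>\<^bsub>free_module S n\<^esub> v = (?w \<oplus>\<^bsub>free_module S n\<^esub> v) \<ominus>\<^bsub>free_module S n\<^esub> v"
    unfolding * ..
  also have "\<dots> = ?w" using w assms(3) by (simp add: a_minus_def F.M.a_assoc F.M.r_neg)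
  finally show ?thesis .
qed

text \<open>Negation is a unique inverse sought in the carrier, so it is not visibly the same
  operation in \<open>R\<close> and in \<open>T\<close>. The inverse found in \<open>R\<close> is
  also one in \<open>T\<close>, where inverses are unique.\<close>

lemma subring_minus:
  assumes "cring T" "subcring R T" "a \<in> R" "b \<in> R"
  shows "a \<ominus>\<^bsub>T\<lparr>carrier := R\<rparr>\<^esub> b = a \<ominus>\<^bsub>T\<^esub> b"
proof -
  interpret T: cring T by fact
  interpret R: cring "T\<lparr>carrier := R\<rparr>"
    using T.subcring_iff assms(2) subcringE(1) by blast
  have "\<ominus>\<^bsub>T\<lparr>carrier := R\<rparr>\<^esub> b \<in> R" "\<ominus>\<^bsub>T\<lparr>carrier := R\<rparr>\<^esub> b \<oplus>\<^bsub>T\<^esub> b = \<zero>\<^bsub>T\<^esub>"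
    using R.a_inv_closed[of b] R.l_neg[of b] assms(4) by simp_all
  then have "\<ominus>\<^bsub>T\<^esub> b = \<ominus>\<^bsub>T\<lparr>carrier := R\<rparr>\<^esub> b"
    using subcringE(1)[OF assms(2)] assms(4) by (intro T.minus_equality) auto
  then show ?thesis by (simp add: a_minus_def)
qed

lemma ring_comb_subring:
  assumes "cring T" "subcring R T" "x \<in> {..<n} \<rightarrow> R" "r \<in> carrier (free_module (T\<lparr>carrier := R\<rparr>) n)"
  shows "ring_comb (T\<lparr>carrier := R\<rparr>) n x r = ring_comb T n x r"
proof -
  interpret T: cring T by fact
  interpret R: cring "T\<lparr>carrier := R\<rparr>"
    using T.subcring_iff assms(2) subcringE(1) by blast
  show ?thesis
    unfolding ring_comb_def
    using finsum_carrier_mono[OF R.abelian_monoid_axioms T.abelian_monoid_axioms,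
        of "{..<n}" "\<lambda>i. r i \<otimes>\<^bsub>T\<^esub> x i"] subcringE(1)[OF assms(2)] subcringE(6)[OF assms(2)] assms(3,4)
    by (auto simp: free_module_simps Pi_iff PiE_iff)
qed

lemma free_module_subring:
  assumes "cring T" "subcring R T" "u \<in> carrier (free_module (T\<lparr>carrier := R\<rparr>) n)"
  shows "u \<in> carrier (free_module T n)"
  using subcringE(1)[OF assms(2)] assms(3) by (auto simp: free_module_simps PiE_iff)

lemma free_module_subring_minus:
  assumes "cring T" "subcring R T"
    and "u \<in> carrier (free_module (T\<lparr>carrier := R\<rparr>) n)"
    and "v \<in> carrier (free_module (T\<lparr>carrier := R\<rparr>) n)"
  shows "u \<ominus>\<^bsub>free_module (T\<lparr>carrier := R\<rparr>) n\<^esub> v = u \<ominus>\<^bsub>free_module T n\<^esub> v"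
proof -
  interpret T: cring T by fact
  have R: "cring (T\<lparr>carrier := R\<rparr>)"
    using T.subcring_iff assms(2) subcringE(1) by blast
  have "u i \<in> R" "v i \<in> R" if "i < n" for i
    using that assms(3,4) by (auto simp: free_module_simps)
  then show ?thesis
    unfolding free_module_minus[OF R assms(3,4)]
      free_module_minus[OF assms(1) assms(3,4)[THEN free_module_subring[OF assms(1,2)]]]
    by (intro restrict_ext) (simp add: subring_minus[OF assms(1,2)])
qed

lemma (in module) smult_r_diff:
  "a \<in> carrier R \<Longrightarrow> x \<in> carrier M \<Longrightarrow> y \<in> carrier M \<Longrightarrow>
    a \<odot>\<^bsub>M\<^esub> (x \<ominus>\<^bsub>M\<^esub> y) = a \<odot>\<^bsub>M\<^esub> x \<ominus>\<^bsub>M\<^esub> a \<odot>\<^bsub>M\<^esub> y"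
  by (simp add: a_minus_def smult_r_distr smult_r_minus)

text \<open>In \<open>R \<otimes> T\<close> each \<open>x_i \<otimes> t_i\<close> equals
  \<open>1 \<otimes> x_i t_i\<close>, and these add up to \<open>1 \<otimes> 0\<close>. Flatness for
  the inclusion of \<open>I\<close> into \<open>R\<close> moves the vanishing back to
  \<open>I \<otimes> T\<close>.\<close>

lemma flat_syzygies_tensor_null:
  assumes T: "cring T" and R: "subcring R T"
    and flat: "flat_module (T\<lparr>carrier := R\<rparr>) (mult_module T (carrier T))"
    and I: "ideal I (T\<lparr>carrier := R\<rparr>)" and x: "x \<in> {..<n} \<rightarrow> I"
    and t: "t \<in> syzygies T n x"
  shows "(\<Sum>i<n. frag_of (encode (x i), t i)) \<in>
    tensor_null (T\<lparr>carrier := R\<rparr>) (encoded_module (T\<lparr>carrier := R\<rparr>) I) (mult_module T (carrier T))"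
proof -
  let ?R = "T\<lparr>carrier := R\<rparr>"
  let ?N = "mult_module T (carrier T)"
  let ?M' = "encoded_module ?R R"
  interpret T: cring T by fact
  have RT: "R \<subseteq> carrier T" using subcringE(1)[OF R] .
  interpret R: cring ?R using T.subcring_iff R RT by blast
  interpret I: ideal I ?R by fact
  have IR: "I \<subseteq> R" using I.a_subset by simp
  have M: "module ?R (encoded_module ?R I)" by (rule module_encoded_module[OF R.is_cring I])
  have M': "module ?R ?M'" using module_encoded_module[OF R.is_cring R.oneideal] by simp
  have N: "module ?R ?N" by (rule module_mult_module_subring[OF T R])
  have t': "t i \<in> carrier T" if "i < n" for i
    using t that by (auto simp: syzygies_def free_module_simps)
  have x': "x i \<in> R" "x i \<in> carrier T" if "i < n" for i
    using x that IR RT by (auto simp: Pi_iff)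
  have one: "encode \<one>\<^bsub>T\<^esub> \<in> carrier ?M'"
    using subcringE(3)[OF R] by (simp add: encoded_module_simps)
  have s: "(\<lambda>i. x i \<otimes>\<^bsub>T\<^esub> t i) \<in> {..<n} \<rightarrow> carrier ?N"
    using x' t' by (simp add: mult_module_simps)
  interpret N: module ?R ?N by (rule N)
  have zero: "(\<Oplus>\<^bsub>?N\<^esub>i\<in>{..<n}. x i \<otimes>\<^bsub>T\<^esub> t i) = \<zero>\<^bsub>?N\<^esub>"
  proof -
    have "(\<Oplus>\<^bsub>?N\<^esub>i\<in>{..<n}. x i \<otimes>\<^bsub>T\<^esub> t i) = lincomb ?N n x t"
      unfolding lincomb_def using x' t'
      by (intro N.M.finsum_cong') (auto simp: mult_module_simps T.m_comm)
    also have "\<dots> = ring_comb T n x t"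
      using T.lincomb_mult_module[OF T.oneideal, of x n t] x' t by (auto simp: syzygies_def)
    finally show ?thesis using t by (simp add: syzygies_def mult_module_simps)
  qed
  have "frag_of (encode (x i), t i) - frag_of (encode \<one>\<^bsub>T\<^esub>, x i \<otimes>\<^bsub>T\<^esub> t i) \<in> tensor_null ?R ?M' ?N"
    if "i < n" for i
    using tensor_null_smult[of "x i" ?R "encode \<one>\<^bsub>T\<^esub>" ?M' "t i" ?N] x' t' that one
    by (simp add: encoded_module_simps mult_module_simps)
  then have "(\<Sum>i<n. frag_of (encode (x i), t i) - frag_of (encode \<one>\<^bsub>T\<^esub>, x i \<otimes>\<^bsub>T\<^esub> t i))
      \<in> tensor_null ?R ?M' ?N"
    by (intro tensor_null_sum) auto
  moreover have "(\<Sum>i<n. frag_of (encode \<one>\<^bsub>T\<^esub>, x i \<otimes>\<^bsub>T\<^esub> t i)) - frag_of (encode \<one>\<^bsub>T\<^esub>, \<zero>\<^bsub>?N\<^esub>)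
      \<in> tensor_null ?R ?M' ?N"
    using tensor_null_sum_right[OF M' N one _ s] zero by simp
  moreover have "frag_of (encode \<one>\<^bsub>T\<^esub>, \<zero>\<^bsub>?N\<^esub>) \<in> tensor_null ?R ?M' ?N"
    by (rule tensor_null_zero_right[OF M' N one])
  \<comment> \<open>The three null elements are added so that all symbols with first entry 1
    cancel.\<close>
  ultimately have "(\<Sum>i<n. frag_of (encode (x i), t i) - frag_of (encode \<one>\<^bsub>T\<^esub>, x i \<otimes>\<^bsub>T\<^esub> t i))
      + ((\<Sum>i<n. frag_of (encode \<one>\<^bsub>T\<^esub>, x i \<otimes>\<^bsub>T\<^esub> t i)) - frag_of (encode \<one>\<^bsub>T\<^esub>, \<zero>\<^bsub>?N\<^esub>)
        + frag_of (encode \<one>\<^bsub>T\<^esub>, \<zero>\<^bsub>?N\<^esub>)) \<in> tensor_null ?R ?M' ?N"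
    by (intro tensor_null_add)
  then have null: "(\<Sum>i<n. frag_of (encode (x i), t i)) \<in> tensor_null ?R ?M' ?N"
    by (simp add: sum_subtractf)
  \<comment> \<open>Both test modules use the same encoding, so the inclusion is the identity
    function and leaves the symbols unchanged.\<close>
  have incl: "(\<lambda>X. X) \<in> linear_maps ?R (encoded_module ?R I) ?M'"
    using IR by (auto simp: linear_maps_def encoded_module_simps)
  have keys: "Poly_Mapping.keys (\<Sum>i<n. frag_of (encode (x i), t i))
      \<subseteq> carrier (encoded_module ?R I) \<times> carrier ?N"
  proof -
    have "Poly_Mapping.keys (\<Sum>i<n. frag_of (encode (x i), t i))
        \<subseteq> (\<Union>i\<in>{..<n}. Poly_Mapping.keys (frag_of (encode (x i), t i)))"
      by (rule Poly_Mapping.keys_sum)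
    then show ?thesis
      using x t' by (auto simp: keys_frag_of encoded_module_simps mult_module_simps)
  qed
  show ?thesis
    by (rule flat_tensor_nullD[OF flat M M' incl _ keys])
      (use null in \<open>simp_all add: frag_extend_sum\<close>)
qed

text \<open>
  The bilinear map sending \<open>(x, t)\<close> to \<open>t\<close> times a coordinate vector of \<open>x\<close> is well defined modulo
  the \<open>T\<close>-span of the syzygies over \<open>R\<close>; it detects the vanishing of a tensor.
\<close>

lemma tensor_null_imp_span_syzygies:
  assumes T: "cring T" and R: "subcring R T" and I: "ideal I (T\<lparr>carrier := R\<rparr>)"
    and x: "x \<in> {..<n} \<rightarrow> R"
    and \<rho>: "\<And>a. a \<in> I \<Longrightarrow> \<rho> a \<in> carrier (free_module (T\<lparr>carrier := R\<rparr>) n)"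
      "\<And>a. a \<in> I \<Longrightarrow> ring_comb (T\<lparr>carrier := R\<rparr>) n x (\<rho> a) = a"
    and h: "h \<in> hom (free_Abelian_group (encode ` I \<times> carrier T)) (add_monoid (free_module T n))"
      "\<And>a t. a \<in> I \<Longrightarrow> t \<in> carrier T \<Longrightarrow> h (frag_of (encode a, t)) = t \<odot>\<^bsub>free_module T n\<^esub> \<rho> a"
    and z: "z \<in> tensor_null (T\<lparr>carrier := R\<rparr>) (encoded_module (T\<lparr>carrier := R\<rparr>) I)
      (mult_module T (carrier T))"
  shows "h z \<in> lin_span T (free_module T n) (syzygies (T\<lparr>carrier := R\<rparr>) n x)"
proof -
  let ?R = "T\<lparr>carrier := R\<rparr>"
  let ?N = "mult_module T (carrier T)"
  let ?M = "encoded_module ?R I"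
  let ?F = "free_module T n"
  let ?FR = "free_module ?R n"
  let ?G = "free_Abelian_group (encode ` I \<times> carrier T)"
  let ?S = "syzygies ?R n x"
  let ?K = "lin_span T ?F ?S"
  interpret T: cring T by fact
  have RT: "R \<subseteq> carrier T" using subcringE(1)[OF R] .
  interpret R: cring ?R using T.subcring_iff R RT by blast
  interpret I: ideal I ?R by fact
  have IR: "I \<subseteq> R" using I.a_subset by simp
  interpret F: module T ?F by (rule module_free_module[OF T])
  interpret FR: module ?R ?FR by (rule module_free_module[OF R.is_cring])
  interpret RR: module ?R "mult_module ?R R" using R.module_mult_module_self by simp
  have M: "module ?R ?M" by (rule module_encoded_module[OF R.is_cring I])
  have N: "module ?R ?N" by (rule module_mult_module_subring[OF T R])
  interpret h: group_hom ?G "add_monoid ?F" h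
    using h(1) F.M.add.group_axioms by (simp add: group_hom_def group_hom_axioms_def)
  have comb: "ring_comb ?R n x \<in> linear_maps ?R ?FR (mult_module ?R R)"
    using R.ring_comb_linear[of x n] x by simp
  note comb' = linear_mapsD[OF comb]
  have SF: "?S \<subseteq> carrier ?F"
    using free_module_subring[OF T R] by (auto simp: syzygies_def)
  have \<rho>F: "\<rho> a \<in> carrier ?F" if "a \<in> I" for a
    by (rule free_module_subring[OF T R \<rho>(1)[OF that]])
  have hm: "h (u - v) = h u \<ominus>\<^bsub>?F\<^esub> h v" if "u \<in> carrier ?G" "v \<in> carrier ?G" for u v
  proof -
    have "h (u + - v) = h u \<oplus>\<^bsub>?F\<^esub> h (- v)"
      using h.hom_mult[of u "- v"] that by simp
    also have "h (- v) = \<ominus>\<^bsub>?F\<^esub> h v"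
      using h.hom_inv[of v] that by (simp add: a_inv_def)
    finally show ?thesis by (simp add: a_minus_def)
  qed
  have g: "frag_of (encode a, t) \<in> carrier ?G" if "a \<in> I" "t \<in> carrier T" for a t
    using that by simp
  have gm: "u - v \<in> carrier ?G" if "u \<in> carrier ?G" "v \<in> carrier ?G" for u v
    using that by (auto dest!: subsetD[OF keys_diff])
  have rel: "h w \<in> ?K" if w: "w \<in> tensor_relators ?R ?M ?N" for w
  proof -
    consider (left) a a' t where "a \<in> I" "a' \<in> I" "t \<in> carrier T"
        "w = frag_of (encode (a \<oplus>\<^bsub>T\<^esub> a'), t) - frag_of (encode a, t) - frag_of (encode a', t)"
      | (right) a t t' where "a \<in> I" "t \<in> carrier T" "t' \<in> carrier T"
        "w = frag_of (encode a, t \<oplus>\<^bsub>T\<^esub> t') - frag_of (encode a, t) - frag_of (encode a, t')"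
      | (scale) b a t where "b \<in> R" "a \<in> I" "t \<in> carrier T"
        "w = frag_of (encode (b \<otimes>\<^bsub>T\<^esub> a), t) - frag_of (encode a, b \<otimes>\<^bsub>T\<^esub> t)"
      using w unfolding tensor_relators_def
      by (auto simp: encoded_module_simps mult_module_simps)
    then show ?thesis
    proof cases
      \<comment> \<open>\<open>\<rho>\<close> is an arbitrary choice of coefficients and need not be
        additive. Its defect \<open>?s\<close> has combination zero, so it is a syzygy over
        \<open>R\<close>, and the relator goes to \<open>t\<close> times it.\<close>
      case left
      have aa: "a \<oplus>\<^bsub>T\<^esub> a' \<in> I" using I.a_closed left(1,2) by simp
      let ?u = "\<rho> (a \<oplus>\<^bsub>T\<^esub> a') \<ominus>\<^bsub>?FR\<^esub> \<rho> a"
      let ?s = "?u \<ominus>\<^bsub>?FR\<^esub> \<rho> a'"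
      have u: "?u \<in> carrier ?FR" using \<rho>(1) aa left(1) by (intro FR.M.minus_closed)
      have s: "?s \<in> carrier ?FR" by (rule FR.M.minus_closed[OF u \<rho>(1)[OF left(2)]])
      have "ring_comb ?R n x ?s
          = (a \<oplus>\<^bsub>T\<^esub> a' \<ominus>\<^bsub>mult_module ?R R\<^esub> a) \<ominus>\<^bsub>mult_module ?R R\<^esub> a'"
        using linear_map_diff[OF FR.module_axioms RR.module_axioms comb] u \<rho> aa left(1,2) by simp
      also have "\<dots> = \<zero>\<^bsub>mult_module ?R R\<^esub>"
      proof -
        have a: "a \<in> carrier (mult_module ?R R)" "a' \<in> carrier (mult_module ?R R)"
          using IR left(1,2) by (auto simp: mult_module_simps)
        have "a \<oplus>\<^bsub>T\<^esub> a' = a \<oplus>\<^bsub>mult_module ?R R\<^esub> a'" by (simp add: mult_module_simps)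
        then show ?thesis
          using a by (simp add: a_minus_def RR.M.a_ac RR.M.r_neg RR.M.r_neg1 RR.M.r_neg2)
      qed
      finally have "?s \<in> ?S" using s by (simp add: syzygies_def mult_module_simps)
      moreover have "h w = t \<odot>\<^bsub>?F\<^esub> ?s"
      proof -
        have "h w = (t \<odot>\<^bsub>?F\<^esub> \<rho> (a \<oplus>\<^bsub>T\<^esub> a') \<ominus>\<^bsub>?F\<^esub> t \<odot>\<^bsub>?F\<^esub> \<rho> a) \<ominus>\<^bsub>?F\<^esub> t \<odot>\<^bsub>?F\<^esub> \<rho> a'"
          unfolding left(4) using aa left(1-3) by (simp only: hm gm g h(2))
        also have "\<dots> = t \<odot>\<^bsub>?F\<^esub> (\<rho> (a \<oplus>\<^bsub>T\<^esub> a') \<ominus>\<^bsub>?F\<^esub> \<rho> a \<ominus>\<^bsub>?F\<^esub> \<rho> a')"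
          using \<rho>F aa left(1-3) by (simp add: F.smult_r_diff F.M.minus_closed)
        also have "\<rho> (a \<oplus>\<^bsub>T\<^esub> a') \<ominus>\<^bsub>?F\<^esub> \<rho> a \<ominus>\<^bsub>?F\<^esub> \<rho> a' = ?s"
          using u \<rho>(1) aa left(1,2) by (simp only: free_module_subring_minus[OF T R])
        finally show ?thesis .
      qed
      ultimately show ?thesis using F.span_smult_incl[OF SF _ left(3)] by simp
    next
      \<comment> \<open>In the second argument \<open>h\<close> is additive exactly, because
        \<open>t\<close> enters only as a scalar.\<close>
      case right
      have "h w = ((t \<oplus>\<^bsub>T\<^esub> t') \<odot>\<^bsub>?F\<^esub> \<rho> a \<ominus>\<^bsub>?F\<^esub> t \<odot>\<^bsub>?F\<^esub> \<rho> a) \<ominus>\<^bsub>?F\<^esub> t' \<odot>\<^bsub>?F\<^esub> \<rho> a"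
        unfolding right(4) using right(1-3) by (simp only: hm gm g h(2) T.a_closed)
      also have "\<dots> = \<zero>\<^bsub>?F\<^esub>"
        using \<rho>F right(1-3)
        by (simp add: F.smult_l_distr a_minus_def F.M.a_ac F.M.r_neg F.M.r_neg1 F.M.r_neg2)
      finally show ?thesis by (simp only: lin_span.zero)
    next
      \<comment> \<open>Likewise \<open>\<rho>\<close> commutes with the scalar \<open>b\<close> of
        \<open>R\<close> only up to a syzygy over \<open>R\<close>; commutativity of
        \<open>T\<close> exchanges \<open>b\<close> and \<open>t\<close>.\<close>
      case scale
      have ba: "b \<otimes>\<^bsub>T\<^esub> a \<in> I" using I.I_l_closed scale(1,2) by simp
      have bT: "b \<in> carrier T" using RT scale(1) by blast
      let ?s = "\<rho> (b \<otimes>\<^bsub>T\<^esub> a) \<ominus>\<^bsub>?FR\<^esub> b \<odot>\<^bsub>?FR\<^esub> \<rho> a"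
      have b\<rho>: "b \<odot>\<^bsub>?FR\<^esub> \<rho> a \<in> carrier ?FR" using \<rho>(1) scale(1,2) by (intro FR.smult_closed) auto
      have s: "?s \<in> carrier ?FR" using \<rho>(1) ba b\<rho> by (intro FR.M.minus_closed)
      have "ring_comb ?R n x ?s = b \<otimes>\<^bsub>T\<^esub> a \<ominus>\<^bsub>mult_module ?R R\<^esub> b \<otimes>\<^bsub>T\<^esub> a"
        using linear_map_diff[OF FR.module_axioms RR.module_axioms comb] b\<rho> \<rho> ba scale(1,2)
          comb'(3)[of b "\<rho> a"]
        by (simp add: mult_module_simps)
      also have "\<dots> = \<zero>\<^bsub>mult_module ?R R\<^esub>"
      proof -
        have "b \<otimes>\<^bsub>T\<^esub> a \<in> carrier (mult_module ?R R)" using IR ba by (auto simp: mult_module_simps)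
        then show ?thesis by (simp add: a_minus_def RR.M.r_neg)
      qed
      finally have "?s \<in> ?S" using s by (simp add: syzygies_def mult_module_simps)
      moreover have "h w = t \<odot>\<^bsub>?F\<^esub> ?s"
      proof -
        have "h w = t \<odot>\<^bsub>?F\<^esub> \<rho> (b \<otimes>\<^bsub>T\<^esub> a) \<ominus>\<^bsub>?F\<^esub> (b \<otimes>\<^bsub>T\<^esub> t) \<odot>\<^bsub>?F\<^esub> \<rho> a"
          unfolding scale(4) using ba bT scale(2,3) by (simp only: hm gm g h(2) T.m_closed)
        also have "(b \<otimes>\<^bsub>T\<^esub> t) \<odot>\<^bsub>?F\<^esub> \<rho> a = t \<odot>\<^bsub>?F\<^esub> (b \<odot>\<^bsub>?F\<^esub> \<rho> a)"
          using \<rho>F scale(2,3) bT by (simp add: T.m_comm[of b t] F.smult_assoc1)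
        also have "t \<odot>\<^bsub>?F\<^esub> \<rho> (b \<otimes>\<^bsub>T\<^esub> a) \<ominus>\<^bsub>?F\<^esub> t \<odot>\<^bsub>?F\<^esub> (b \<odot>\<^bsub>?F\<^esub> \<rho> a)
            = t \<odot>\<^bsub>?F\<^esub> (\<rho> (b \<otimes>\<^bsub>T\<^esub> a) \<ominus>\<^bsub>?F\<^esub> b \<odot>\<^bsub>?F\<^esub> \<rho> a)"
          using \<rho>F ba scale(2,3) bT by (simp add: F.smult_r_diff)
        also have "b \<odot>\<^bsub>?F\<^esub> \<rho> a = b \<odot>\<^bsub>?FR\<^esub> \<rho> a" by (simp add: free_module_simps)
        also have "\<rho> (b \<otimes>\<^bsub>T\<^esub> a) \<ominus>\<^bsub>?F\<^esub> b \<odot>\<^bsub>?FR\<^esub> \<rho> a = ?s"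
          using \<rho>(1) ba b\<rho> by (simp only: free_module_subring_minus[OF T R])
        finally show ?thesis .
      qed
      ultimately show ?thesis using F.span_smult_incl[OF SF _ scale(3)] by simp
    qed
  qed
  have relc: "w \<in> carrier ?G" if "w \<in> tensor_relators ?R ?M ?N" for w
    using subsetD[OF tensor_relators_subset[OF M N] that]
    unfolding encoded_module_simps mult_module_simps .
  have "z \<in> carrier ?G \<and> h z \<in> ?K"
    using z unfolding tensor_null_def
  proof (induction rule: generate.induct)
    case one
    have "h 0 = \<zero>\<^bsub>?F\<^esub>" using h.hom_one by simp
    then show ?case by (simp add: lin_span.zero)
  next
    case (incl w)
    then show ?case using rel relc by blast
  next
    case (inv w)
    have "w \<in> carrier ?G" "h w \<in> ?K" using inv rel relc by auto
    then have "- w \<in> carrier ?G" "h (- w) = \<zero>\<^bsub>?F\<^esub> \<ominus>\<^bsub>?F\<^esub> h w"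
      using hm[of 0 w] h.hom_one by simp_all
    then show ?case
      using F.span_diff[OF SF lin_span.zero \<open>h w \<in> ?K\<close>] \<open>w \<in> carrier ?G\<close>
      by (simp add: encoded_module_simps mult_module_simps)
  next
    case (eng w1 w2)
    then show ?case
      using h.hom_mult[of w1 w2] F.span_add[OF SF, of "h w1" "h w2"]
      by (auto dest!: subsetD[OF keys_add])
  qed
  then show ?thesis by blast
qed

text \<open>Work modulo the \<open>T\<close>-span of the syzygies over \<open>R\<close>. With
  \<open>\<rho>\<close> a choice of coefficients over \<open>R\<close>, the vector \<open>t\<close>
  is congruent to the sum of the \<open>t_i \<rho> (x_i)\<close>, since the i-th unit vector and
  \<open>\<rho> (x_i)\<close> both have combination \<open>x_i\<close>. That sum is the coordinate
  image of the vanishing tensor, so it is congruent to zero.\<close>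

lemma flat_syzygies:
  assumes T: "cring T" and R: "subcring R T"
    and flat: "flat_module (T\<lparr>carrier := R\<rparr>) (mult_module T (carrier T))"
    and x: "x \<in> {..<n} \<rightarrow> R"
  shows "syzygies T n x \<subseteq> lin_span T (free_module T n) (syzygies (T\<lparr>carrier := R\<rparr>) n x)"
proof
  fix t assume t: "t \<in> syzygies T n x"
  let ?R = "T\<lparr>carrier := R\<rparr>"
  let ?F = "free_module T n"
  let ?FR = "free_module ?R n"
  let ?S = "syzygies ?R n x"
  let ?K = "lin_span T ?F ?S"
  interpret T: cring T by fact
  have RT: "R \<subseteq> carrier T" using subcringE(1)[OF R] .
  interpret R: cring ?R using T.subcring_iff R RT by blast
  interpret F: module T ?F by (rule module_free_module[OF T])
  interpret FR: module ?R ?FR by (rule module_free_module[OF R.is_cring])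
  interpret RR: module ?R "mult_module ?R R" using R.module_mult_module_self by simp
  define I where "I = Idl\<^bsub>?R\<^esub> (x ` {..<n})"
  have xs: "x ` {..<n} \<subseteq> carrier ?R" using x by auto
  have I: "ideal I ?R" unfolding I_def by (rule R.genideal_ideal[OF xs])
  have xI: "x \<in> {..<n} \<rightarrow> I" using R.genideal_self[OF xs] by (auto simp: I_def)
  have "\<exists>r. r \<in> carrier ?FR \<and> ring_comb ?R n x r = a" if "a \<in> I" for a
    using R.genideal_eq_ring_comb[of x n] x that unfolding I_def by auto
  then obtain \<rho> where \<rho>: "\<And>a. a \<in> I \<Longrightarrow> \<rho> a \<in> carrier ?FR"
    "\<And>a. a \<in> I \<Longrightarrow> ring_comb ?R n x (\<rho> a) = a"
    by metis
  have \<rho>F: "\<rho> a \<in> carrier ?F" if "a \<in> I" for a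
    by (rule free_module_subring[OF T R \<rho>(1)[OF that]])
  have im: "(\<lambda>(X, s). s \<odot>\<^bsub>?F\<^esub> \<rho> (decode X)) ` (encode ` I \<times> carrier T)
      \<subseteq> carrier (add_monoid ?F)"
    using \<rho>F by auto
  obtain h where h: "h \<in> hom (free_Abelian_group (encode ` I \<times> carrier T)) (add_monoid ?F)"
    "\<And>p. p \<in> encode ` I \<times> carrier T \<Longrightarrow>
      h (frag_of p) = (case p of (X, s) \<Rightarrow> s \<odot>\<^bsub>?F\<^esub> \<rho> (decode X))"
    by (rule comm_group.free_Abelian_group_universal[OF F.M.a_comm_group im]) (rule that)
  have h2: "h (frag_of (encode a, s)) = s \<odot>\<^bsub>?F\<^esub> \<rho> a" if "a \<in> I" "s \<in> carrier T" for a s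
    using h(2)[of "(encode a, s)"] that by simp
  interpret h: group_hom "free_Abelian_group (encode ` I \<times> carrier T)" "add_monoid ?F" h
    using h(1) F.M.add.group_axioms by (simp add: group_hom_def group_hom_axioms_def)
  have tF: "t \<in> carrier ?F" using t by (simp add: syzygies_def)
  have t': "t i \<in> carrier T" if "i < n" for i
    using tF that by (auto simp: free_module_simps)
  have SF: "?S \<subseteq> carrier ?F"
    using free_module_subring[OF T R] by (auto simp: syzygies_def)
  have x': "x i \<in> I" if "i < n" for i using xI that by auto
  \<comment> \<open>The induction carries the bound on the keys along, because \<open>h\<close> is
    known to be additive only on the carrier of the free abelian group.\<close>
  have "h (\<Sum>i\<in>A. frag_of (encode (x i), t i)) = (\<Oplus>\<^bsub>?F\<^esub>i\<in>A. t i \<odot>\<^bsub>?F\<^esub> \<rho> (x i))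
      \<and> Poly_Mapping.keys (\<Sum>i\<in>A. frag_of (encode (x i), t i)) \<subseteq> encode ` I \<times> carrier T"
    if "finite A" "A \<subseteq> {..<n}" for A
    using that
  proof (induction rule: finite_induct)
    case empty
    then show ?case using h.hom_one by simp
  next
    case (insert a A)
    then have a: "a < n" and A: "A \<subseteq> {..<n}" by auto
    let ?z = "\<Sum>i\<in>A. frag_of (encode (x i), t i)"
    have z: "Poly_Mapping.keys ?z \<subseteq> encode ` I \<times> carrier T" using insert.IH[OF A] by simp
    have "h (frag_of (encode (x a), t a) + ?z) = h (frag_of (encode (x a), t a)) \<oplus>\<^bsub>?F\<^esub> h ?z"
      using h.hom_mult[of "frag_of (encode (x a), t a)" ?z] z x'[OF a] t'[OF a] by simp
    moreover have "(\<lambda>i. t i \<odot>\<^bsub>?F\<^esub> \<rho> (x i)) \<in> A \<rightarrow> carrier ?F" "t a \<odot>\<^bsub>?F\<^esub> \<rho> (x a) \<in> carrier ?F"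
      using A a x' t' \<rho>F by (auto intro!: F.smult_closed)
    moreover have "Poly_Mapping.keys (frag_of (encode (x a), t a) + ?z) \<subseteq> encode ` I \<times> carrier T"
      using keys_add[of "frag_of (encode (x a), t a)" ?z] z x'[OF a] t'[OF a] by auto
    ultimately show ?case
      using insert.IH[OF A] insert.hyps h2[OF x'[OF a] t'[OF a]] by simp
  qed
  from this[of "{..<n}"] have hz: "h (\<Sum>i<n. frag_of (encode (x i), t i)) = lincomb ?F n (\<lambda>i. \<rho> (x i)) t"
    by (simp add: lincomb_def)
  have sum: "lincomb ?F n (\<lambda>i. \<rho> (x i)) t \<in> ?K"
    unfolding hz[symmetric]
    by (rule tensor_null_imp_span_syzygies[OF T R I x \<rho> h(1) h2
          flat_syzygies_tensor_null[OF T R flat I xI t]])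
  have \<rho>x: "(\<lambda>i. \<rho> (x i)) \<in> {..<n} \<rightarrow> carrier ?F" using \<rho>F x' by auto
  \<comment> \<open>\<open>k\<close> measures the error of replacing each unit vector by
    \<open>\<rho> (x i)\<close>; it sends unit vectors to syzygies over \<open>R\<close>, so by
    \<open>T\<close>-linearity \<open>k t\<close> lies in their \<open>T\<close>-span.\<close>
  define k where "k s = s \<ominus>\<^bsub>?F\<^esub> lincomb ?F n (\<lambda>i. \<rho> (x i)) s" for s
  have id: "(\<lambda>r. r) \<in> linear_maps T ?F ?F" by (auto simp: linear_maps_def)
  have k: "k \<in> linear_maps T ?F ?F"
    unfolding k_def
    by (rule linear_map_minus[OF F.module_axioms F.module_axioms id F.lincomb_linear[OF \<rho>x]])
  have "k (unit_vec T n i) \<in> ?S" if i: "i < n" for i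
  proof -
    have u: "unit_vec ?R n i = unit_vec T n i" unfolding unit_vec_def by (intro restrict_ext) simp
    have uF: "unit_vec T n i \<in> carrier ?FR" using R.is_cring FR.unit_vec_closed[of n i] u by simp
    have "k (unit_vec T n i) = unit_vec T n i \<ominus>\<^bsub>?F\<^esub> \<rho> (x i)"
      unfolding k_def using F.lincomb_unit[OF \<rho>x i] by simp
    also have "\<dots> = unit_vec T n i \<ominus>\<^bsub>?FR\<^esub> \<rho> (x i)"
      using free_module_subring_minus[OF T R uF \<rho>(1)[OF x'[OF i]]] by simp
    finally have e: "k (unit_vec T n i) = unit_vec T n i \<ominus>\<^bsub>?FR\<^esub> \<rho> (x i)" .
    have xc: "x \<in> {..<n} \<rightarrow> carrier ?R" using x by simp
    have xm: "x \<in> {..<n} \<rightarrow> carrier (mult_module ?R R)" using x by (simp add: mult_module_simps)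
    have "ring_comb ?R n x (unit_vec T n i) = x i"
      using RR.lincomb_unit[OF xm i] R.lincomb_mult_module[OF R.oneideal xc uF] u by simp
    then have "ring_comb ?R n x (unit_vec T n i \<ominus>\<^bsub>?FR\<^esub> \<rho> (x i)) = x i \<ominus>\<^bsub>mult_module ?R R\<^esub> x i"
      using linear_map_diff[OF FR.module_axioms RR.module_axioms _ uF \<rho>(1)[OF x'[OF i]], of "ring_comb ?R n x"]
        R.ring_comb_linear[OF xc] \<rho>(2)[OF x'[OF i]] by simp
    also have "\<dots> = \<zero>\<^bsub>T\<^esub>"
      using RR.M.r_neg[of "x i"] xm i by (auto simp: a_minus_def mult_module_simps)
    finally show ?thesis
      unfolding e syzygies_def using FR.M.minus_closed[OF uF \<rho>(1)[OF x'[OF i]]] by simp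
  qed
  then have "(\<lambda>i. k (unit_vec T n i)) ` {..<n} \<subseteq> ?S" by auto
  from span_mono[OF this, of T ?F] have "k t \<in> ?K"
    using F.linear_image_free_module[OF k] tF by blast
  then have "k t \<oplus>\<^bsub>?F\<^esub> lincomb ?F n (\<lambda>i. \<rho> (x i)) t \<in> ?K"
    by (rule F.span_add[OF SF _ sum])
  moreover have "k t \<oplus>\<^bsub>?F\<^esub> lincomb ?F n (\<lambda>i. \<rho> (x i)) t = t"
    using tF subsetD[OF F.span_subset[OF SF] sum]
    by (simp add: k_def a_minus_def F.M.a_assoc F.M.l_neg)
  ultimately show "t \<in> ?K" by simp
qed

section \<open>The descent along the conductor square\<close>

text \<open>The single generator 1 of the unit ideal has only the zero syzygy, so the unit ideal is
  finitely presented. Independence of the generators transfers this to the family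
  \<open>x\<close>.\<close>

lemma (in cring) finitely_spanned_syzygies_unimodular:
  assumes x: "x \<in> {..<n} \<rightarrow> carrier R" and gen: "Idl (x ` {..<n}) = carrier R"
  shows "finitely_spanned R (free_module R n) (syzygies R n x)"
proof -
  have one: "(\<lambda>_::nat. \<one>) \<in> {..<1} \<rightarrow> carrier R" by simp
  have "r = \<zero>\<^bsub>free_module R 1\<^esub>" if "r \<in> syzygies R 1 (\<lambda>_. \<one>)" for r
    using that
    by (auto simp: syzygies_def ring_comb_def free_module_simps lessThan_Suc PiE_iff
        extensional_def fun_eq_iff)
  then have "finitely_spanned R (free_module R 1) (syzygies R 1 (\<lambda>_. \<one>))"
    unfolding finitely_spanned_def
    by (intro exI[of _ "{}"]) (metis empty_subsetI finite.emptyI lin_span.zero subsetI)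
  moreover have "(\<lambda>_::nat. \<one>) ` {..<1} = {\<one>}" by auto
  ultimately have "finitely_presented R (mult_module R (carrier R))"
    using finitely_presented_genideal_iff[OF one] by (simp add: genideal_one)
  then show ?thesis using finitely_presented_genideal_iff[OF x] gen by simp
qed

section \<open>Spans with coefficients in \<open>R\<close> and in \<open>T\<close>\<close>

lemma free_module_subring_ops:
  "\<zero>\<^bsub>free_module (T\<lparr>carrier := R\<rparr>) n\<^esub> = \<zero>\<^bsub>free_module T n\<^esub>"
  "x \<oplus>\<^bsub>free_module (T\<lparr>carrier := R\<rparr>) n\<^esub> y = x \<oplus>\<^bsub>free_module T n\<^esub> y"
  "a \<odot>\<^bsub>free_module (T\<lparr>carrier := R\<rparr>) n\<^esub> x = a \<odot>\<^bsub>free_module T n\<^esub> x"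
  unfolding free_module_simps by (intro restrict_ext; simp)+

lemma lin_span_subring:
  assumes "R \<subseteq> carrier T"
  shows "lin_span (T\<lparr>carrier := R\<rparr>) (free_module (T\<lparr>carrier := R\<rparr>) n) G \<subseteq> lin_span T (free_module T n) G"
proof
  fix z assume "z \<in> lin_span (T\<lparr>carrier := R\<rparr>) (free_module (T\<lparr>carrier := R\<rparr>) n) G"
  then show "z \<in> lin_span T (free_module T n) G"
  proof induction
    case zero
    then show ?case using lin_span.zero[of "free_module T n" T G] by (simp add: free_module_subring_ops)
  next
    case (step a g z)
    then show ?case
      using lin_span.step[of a T g G z "free_module T n"] assms
      by (auto simp: free_module_subring_ops)
  qed
qed

text \<open>Each coefficient \<open>a\<close> in \<open>T\<close> becomes \<open>ca\<close>, which
  lies in \<open>R\<close>. The vectors of \<open>G\<close> stay fixed, so syzygies that span over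
  \<open>T\<close> become usable over \<open>R\<close> after multiplication by
  \<open>c\<close>.\<close>

lemma smult_span_subring:
  assumes T: "cring T" and c: "c \<in> carrier T" "\<And>a. a \<in> carrier T \<Longrightarrow> c \<otimes>\<^bsub>T\<^esub> a \<in> R"
    and G: "G \<subseteq> carrier (free_module T n)" and z: "z \<in> lin_span T (free_module T n) G"
  shows "c \<odot>\<^bsub>free_module T n\<^esub> z
    \<in> lin_span (T\<lparr>carrier := R\<rparr>) (free_module (T\<lparr>carrier := R\<rparr>) n) G"
proof -
  interpret T: cring T by fact
  interpret F: module T "free_module T n" by (rule module_free_module[OF T])
  let ?K = "lin_span (T\<lparr>carrier := R\<rparr>) (free_module (T\<lparr>carrier := R\<rparr>) n) G"
  have K0: "\<zero>\<^bsub>free_module T n\<^esub> \<in> ?K"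
    using lin_span.zero[of "free_module (T\<lparr>carrier := R\<rparr>) n" "T\<lparr>carrier := R\<rparr>" G]
    by (simp add: free_module_subring_ops)
  have Kstep: "a \<odot>\<^bsub>free_module T n\<^esub> g \<oplus>\<^bsub>free_module T n\<^esub> s \<in> ?K"
    if "a \<in> R" "g \<in> G" "s \<in> ?K" for a g s
    using lin_span.step[of a "T\<lparr>carrier := R\<rparr>" g G s "free_module (T\<lparr>carrier := R\<rparr>) n"] that
    by (simp add: free_module_subring_ops)
  show ?thesis
    using z
  proof induction
    case zero
    then show ?case using K0 c by simp
  next
    case (step a g s)
    have gs: "g \<in> carrier (free_module T n)" "s \<in> carrier (free_module T n)"
      using step(2,3) G F.span_subset[OF G] by auto
    have "(c \<otimes>\<^bsub>T\<^esub> a) \<odot>\<^bsub>free_module T n\<^esub> g \<oplus>\<^bsub>free_module T n\<^esub> c \<odot>\<^bsub>free_module T n\<^esub> s \<in> ?K"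
      by (rule Kstep[OF c(2)[OF step.hyps(1)] step.hyps(2) step.IH])
    then show ?case using gs c(1) step(1) by (simp add: F.smult_r_distr F.smult_assoc1)
  qed
qed

text \<open>Each of finitely many generators over \<open>T\<close> is a \<open>T\<close>-combination
  of finitely many syzygies over \<open>R\<close>; the syzygies occurring in these combinations
  already span.\<close>

lemma flat_syzygies_finite:
  assumes T: "cring T" and R: "subcring R T"
    and flat: "flat_module (T\<lparr>carrier := R\<rparr>) (mult_module T (carrier T))"
    and x: "x \<in> {..<n} \<rightarrow> R"
    and fin: "finitely_spanned T (free_module T n) (syzygies T n x)"
  shows "\<exists>G\<subseteq>syzygies (T\<lparr>carrier := R\<rparr>) n x. finite G \<and>
    syzygies T n x \<subseteq> lin_span T (free_module T n) G"
proof -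
  interpret T: cring T by fact
  interpret F: module T "free_module T n" by (rule module_free_module[OF T])
  obtain Z where Z: "Z \<subseteq> syzygies T n x" "finite Z"
    "syzygies T n x \<subseteq> lin_span T (free_module T n) Z"
    using fin unfolding finitely_spanned_def by blast
  have "Z \<subseteq> lin_span T (free_module T n) (syzygies (T\<lparr>carrier := R\<rparr>) n x)"
    using Z(1) flat_syzygies[OF T R flat x] by blast
  from finite_subset_span_support[OF Z(2) this]
  obtain G where G: "G \<subseteq> syzygies (T\<lparr>carrier := R\<rparr>) n x" "finite G"
    "Z \<subseteq> lin_span T (free_module T n) G" by blast
  have "G \<subseteq> carrier (free_module T n)"
    using G(1) free_module_subring[OF T R] by (auto simp: syzygies_def)
  then have "syzygies T n x \<subseteq> lin_span T (free_module T n) G"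
    using Z(3) F.span_least[OF _ G(3)] by blast
  then show ?thesis using G by blast
qed

section \<open>Syzygies under scaling and under a surjection of rings\<close>

lemma (in cring) ring_comb_smult:
  assumes "x \<in> {..<n} \<rightarrow> carrier R" "r \<in> carrier (free_module R n)" "c \<in> carrier R"
  shows "ring_comb R n x (c \<odot>\<^bsub>free_module R n\<^esub> r) = c \<otimes> ring_comb R n x r"
  using linear_mapsD(3)[OF ring_comb_linear[OF assms(1)] assms(3,2)] by (simp add: mult_module_simps)

lemma (in cring) ring_comb_closed:
  assumes "x \<in> {..<n} \<rightarrow> carrier R" "r \<in> carrier (free_module R n)"
  shows "ring_comb R n x r \<in> carrier R"
  using linear_mapsD(1)[OF ring_comb_linear[OF assms(1)] assms(2)] by (simp add: mult_module_simps)

lemma (in cring) span_syzygies: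
  assumes "x \<in> {..<n} \<rightarrow> carrier R" "G \<subseteq> syzygies R n x"
  shows "lin_span R (free_module R n) G \<subseteq> syzygies R n x"
proof -
  interpret M: module R "mult_module R (carrier R)" by (rule module_mult_module_self)
  show ?thesis
    using M.span_kernel[OF module_free_module[OF is_cring] ring_comb_linear[OF assms(1)]] assms(2)
    by (simp add: syzygies_def mult_module_simps)
qed

text \<open>Coefficients lift one at a time because \<eta> is surjective, and each generator in the
  image already has a lift in \<open>G\<close>. The lifted combination may differ from a given lift
  of \<open>w\<close> by entries in the kernel.\<close>

lemma lift_span_along_hom:
  assumes R: "cring R" and A: "cring A" and \<eta>: "\<eta> \<in> ring_hom R A" "\<eta> ` carrier R = carrier A"
    and G: "G \<subseteq> carrier (free_module R n)"
    and w: "w \<in> lin_span A (free_module A n) ((\<lambda>r. \<lambda>i\<in>{..<n}. \<eta> (r i)) ` G)"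
  shows "\<exists>k\<in>lin_span R (free_module R n) G. w = (\<lambda>i\<in>{..<n}. \<eta> (k i))"
  using w
proof induction
  interpret R: cring R by fact
  interpret A: cring A by fact
  interpret h: ring_hom_cring R A \<eta> by (intro ring_hom_cring.intro ring_hom_cring_axioms.intro R A \<eta>(1))
  case zero
  show ?case
    by (intro bexI[OF _ lin_span.zero]) (auto simp: free_module_simps intro!: restrict_ext)
next
  interpret R: cring R by fact
  interpret A: cring A by fact
  interpret h: ring_hom_cring R A \<eta> by (intro ring_hom_cring.intro ring_hom_cring_axioms.intro R A \<eta>(1))
  interpret F: module R "free_module R n" by (rule module_free_module[OF R])
  case (step a g w)
  then obtain k where k: "k \<in> lin_span R (free_module R n) G" "w = (\<lambda>i\<in>{..<n}. \<eta> (k i))" by blast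
  obtain b where b: "b \<in> carrier R" "a = \<eta> b" using step(1) \<eta>(2) by auto
  obtain r where r: "r \<in> G" "g = (\<lambda>i\<in>{..<n}. \<eta> (r i))" using step(2) by auto
  have "r \<in> carrier (free_module R n)" "k \<in> carrier (free_module R n)"
    using r(1) k(1) G F.span_subset[OF G] by auto
  then have "r i \<in> carrier R" "k i \<in> carrier R" if "i < n" for i
    using that by (auto simp: free_module_simps)
  then have "a \<odot>\<^bsub>free_module A n\<^esub> g \<oplus>\<^bsub>free_module A n\<^esub> w =
      (\<lambda>i\<in>{..<n}. \<eta> ((b \<odot>\<^bsub>free_module R n\<^esub> r \<oplus>\<^bsub>free_module R n\<^esub> k) i))"
    unfolding b(2) r(2) k(2) using b(1) by (auto simp: free_module_simps intro!: restrict_ext)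
  then show ?case using lin_span.step[OF b(1) r(1) k(1)] by blast
qed

lemma ring_comb_hom:
  assumes R: "cring R" and A: "cring A" and \<eta>: "\<eta> \<in> ring_hom R A"
    and x: "x \<in> {..<n} \<rightarrow> carrier R" and r: "r \<in> carrier (free_module R n)"
  shows "ring_comb A n (\<lambda>i. \<eta> (x i)) (\<lambda>i\<in>{..<n}. \<eta> (r i)) = \<eta> (ring_comb R n x r)"
proof -
  interpret R: cring R by fact
  interpret A: cring A by fact
  interpret h: ring_hom_cring R A \<eta> by (intro ring_hom_cring.intro ring_hom_cring_axioms.intro R A \<eta>)
  have c: "r i \<in> carrier R" "x i \<in> carrier R" if "i < n" for i
    using r x that by (auto simp: free_module_simps)
  have "\<eta> (ring_comb R n x r) = (\<Oplus>\<^bsub>A\<^esub>i\<in>{..<n}. (\<eta> \<circ> (\<lambda>i. r i \<otimes>\<^bsub>R\<^esub> x i)) i)"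
    unfolding ring_comb_def using c by (subst h.hom_finsum) (auto simp: comp_def)
  also have "\<dots> = ring_comb A n (\<lambda>i. \<eta> (x i)) (\<lambda>i\<in>{..<n}. \<eta> (r i))"
    unfolding ring_comb_def using c by (intro A.finsum_cong') auto
  finally show ?thesis ..
qed

text \<open>
  The ideal \<open>C = cT\<close> absorbs the syzygies with entries in \<open>C\<close>: dividing by \<open>c\<close> gives a syzygy
  over \<open>T\<close>, a \<open>T\<close>-combination of finitely many syzygies over \<open>R\<close>, and multiplying back
  by \<open>c\<close> moves the coefficients into \<open>R\<close>. Modulo \<open>C\<close> every syzygy lifts, because the
  generators span the unit ideal of \<open>T\<close>, so that \<open>C\<close> lies in the ideal of \<open>R\<close> they generate.
\<close>

lemma finitely_spanned_syzygies_subring: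
  assumes T: "cring T" and R: "subcring R T"
    and flat: "flat_module (T\<lparr>carrier := R\<rparr>) (mult_module T (carrier T))"
    and C: "ideal C (T\<lparr>carrier := R\<rparr>)" "ideal C T"
    and c: "c \<in> C" "non_zero_divisor T c" "\<And>d. d \<in> C \<Longrightarrow> \<exists>t\<in>carrier T. d = c \<otimes>\<^bsub>T\<^esub> t"
    and coh: "coherent_ring (T\<lparr>carrier := R\<rparr> Quot C)"
    and x: "x \<in> {..<n} \<rightarrow> R" and gen: "Idl\<^bsub>T\<^esub> (x ` {..<n}) = carrier T"
  shows "finitely_spanned (T\<lparr>carrier := R\<rparr>) (free_module (T\<lparr>carrier := R\<rparr>) n)
    (syzygies (T\<lparr>carrier := R\<rparr>) n x)"
proof -
  let ?R = "T\<lparr>carrier := R\<rparr>"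
  let ?A = "?R Quot C"
  let ?F = "free_module T n"
  let ?FR = "free_module ?R n"
  let ?FA = "free_module ?A n"
  let ?S = "syzygies ?R n x"
  let ?ST = "syzygies T n x"
  let ?\<eta> = "\<lambda>a. C +>\<^bsub>?R\<^esub> a"
  let ?\<pi> = "\<lambda>r. \<lambda>i\<in>{..<n}. ?\<eta> (r i)"
  let ?y = "\<lambda>i. ?\<eta> (x i)"
  interpret T: cring T by fact
  have RT: "R \<subseteq> carrier T" using subcringE(1)[OF R] .
  interpret R: cring ?R using T.subcring_iff R RT by blast
  interpret C: ideal C ?R by fact
  interpret CT: ideal C T by fact
  have CR: "C \<subseteq> R" using C.a_subset by simp
  have cT: "c \<in> carrier T" using c(2) by (simp add: non_zero_divisor_def)
  interpret F: module T ?F by (rule module_free_module[OF T])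
  interpret FR: module ?R ?FR by (rule module_free_module[OF R.is_cring])
  have A: "cring ?A" by (rule C.quotient_is_cring[OF R.is_cring])
  interpret A: cring ?A by (rule A)
  interpret \<eta>: ring_hom_cring ?R ?A ?\<eta> by (rule C.rcos_ring_hom_cring[OF R.is_cring])
  have \<eta>: "?\<eta> \<in> ring_hom ?R ?A" by (rule C.rcos_ring_hom)
  have \<eta>s: "?\<eta> ` carrier ?R = carrier ?A"
    by (auto simp: FactRing_def A_RCOSETS_def')
  have \<eta>c: "?\<eta> a \<in> carrier ?A" if "a \<in> R" for a using \<eta>.hom_closed[of a] that by simp
  have \<eta>eq: "a \<ominus>\<^bsub>T\<^esub> b \<in> C \<longleftrightarrow> ?\<eta> a = ?\<eta> b" if "a \<in> R" "b \<in> R" for a b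
    using R.quotient_eq_iff_same_a_r_cos[OF C(1), of a b] that subring_minus[OF T R that] by simp
  have xT: "x \<in> {..<n} \<rightarrow> carrier T" and xR: "x \<in> {..<n} \<rightarrow> carrier ?R" using x RT by auto
  have y: "?y \<in> {..<n} \<rightarrow> carrier ?A"
    by (rule Pi_I, rule \<eta>c) (use x in auto)
  have comb: "ring_comb ?R n x r = ring_comb T n x r" if "r \<in> carrier ?FR" for r
    by (rule ring_comb_subring[OF T R x that])
  have S_ST: "?S \<subseteq> ?ST"
    using comb free_module_subring[OF T R] by (auto simp: syzygies_def)
  have linT: "ring_comb T n x \<in> linear_maps T ?F (mult_module T (carrier T))"
    by (rule T.ring_comb_linear[OF xT])
  obtain G1 where G1: "G1 \<subseteq> ?S" "finite G1" "?ST \<subseteq> lin_span T ?F G1"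
    using flat_syzygies_finite[OF T R flat x T.finitely_spanned_syzygies_unimodular[OF xT gen]]
    by blast
  have "finitely_spanned ?A ?FA (syzygies ?A n ?y)"
    using coh A.coherent_ring_iff_syzygies y by blast
  then obtain GA where GA: "GA \<subseteq> syzygies ?A n ?y" "finite GA"
    "syzygies ?A n ?y \<subseteq> lin_span ?A ?FA GA"
    unfolding finitely_spanned_def by blast
  have "\<one>\<^bsub>T\<^esub> \<in> ring_comb T n x ` carrier ?F"
    using T.genideal_eq_ring_comb[OF xT] gen by blast
  then obtain u where u: "u \<in> carrier ?F" "ring_comb T n x u = \<one>\<^bsub>T\<^esub>" by auto
  have lift: "\<exists>r\<in>?S. ?\<pi> r = w" if w: "w \<in> syzygies ?A n ?y" for w
  proof -
    have wA: "w \<in> {..<n} \<rightarrow>\<^sub>E ?\<eta> ` carrier ?R"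
      using w \<eta>s by (simp add: syzygies_def free_module_simps)
    then have "\<forall>i\<in>{..<n}. \<exists>a. a \<in> R \<and> w i = ?\<eta> a" by (auto simp: PiE_iff)
    then obtain r0 where r0: "\<And>i. i < n \<Longrightarrow> r0 i \<in> R \<and> w i = ?\<eta> (r0 i)"
      by (metis lessThan_iff)
    define r where "r = (\<lambda>i\<in>{..<n}. r0 i)"
    have r: "r \<in> carrier ?FR" using r0 by (simp add: r_def free_module_simps)
    have \<pi>r: "?\<pi> r = w"
      using r0 wA by (auto simp: r_def PiE_iff extensional_def fun_eq_iff)
    define d where "d = ring_comb ?R n x r"
    have dR: "d \<in> R" using R.ring_comb_closed[OF xR r] by (simp add: d_def)
    have "?\<eta> d = \<zero>\<^bsub>?A\<^esub>"
      using ring_comb_hom[OF R.is_cring A \<eta> xR r] w \<pi>r by (simp add: d_def syzygies_def)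
    then have "?\<eta> d = ?\<eta> \<zero>\<^bsub>T\<^esub>" using \<eta>.hom_zero by simp
    then have dC: "d \<in> C"
      using \<eta>eq[OF dR subcringE(2)[OF R]] dR RT by (auto simp: a_minus_def)
    \<comment> \<open>\<open>d\<close> is the defect of the naive lift \<open>r\<close> and lies in
      \<open>C\<close>. Since \<open>u\<close> has combination 1, \<open>e\<close> has combination
      \<open>d\<close>; its entries lie in \<open>C\<close> because \<open>C\<close> is an ideal of
      \<open>T\<close>. Subtracting \<open>e\<close> removes the defect and keeps the
      residues.\<close>
    define e where "e = d \<odot>\<^bsub>?F\<^esub> u"
    have dT: "d \<in> carrier T" using dR RT by blast
    have ui: "u i \<in> carrier T" if "i < n" for i using u(1) that by (auto simp: free_module_simps)
    have eC: "e i \<in> C" if "i < n" for i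
      using that dC ui CT.I_r_closed by (simp add: e_def free_module_simps)
    have eF: "e \<in> carrier ?F" unfolding e_def using dT u(1) by (rule F.smult_closed)
    then have e: "e \<in> carrier ?FR"
      using eC CR by (auto simp: free_module_simps PiE_iff)
    have re: "r \<ominus>\<^bsub>?FR\<^esub> e \<in> carrier ?FR" by (rule FR.M.minus_closed[OF r e])
    have "ring_comb T n x (r \<ominus>\<^bsub>?F\<^esub> e) = ring_comb T n x r \<ominus>\<^bsub>mult_module T (carrier T)\<^esub> ring_comb T n x e"
      by (rule linear_map_diff[OF F.module_axioms T.module_mult_module_self linT
            free_module_subring[OF T R r] eF])
    moreover have "ring_comb T n x e = d"
      unfolding e_def using T.ring_comb_smult[OF xT u(1) dT] u(2) dT by simp
    moreover have "ring_comb T n x r = d" using comb[OF r] by (simp add: d_def)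
    moreover have "d \<ominus>\<^bsub>mult_module T (carrier T)\<^esub> d = \<zero>\<^bsub>T\<^esub>"
    proof -
      interpret M: module T "mult_module T (carrier T)" by (rule T.module_mult_module_self)
      show ?thesis using M.M.r_neg[of d] dT by (simp add: a_minus_def mult_module_simps)
    qed
    ultimately have "r \<ominus>\<^bsub>?FR\<^esub> e \<in> ?S"
      using re comb[OF re] free_module_subring_minus[OF T R r e] by (simp add: syzygies_def)
    moreover have "?\<pi> (r \<ominus>\<^bsub>?FR\<^esub> e) = w"
    proof -
      have "?\<eta> ((r \<ominus>\<^bsub>?FR\<^esub> e) i) = ?\<eta> (r i)" if i: "i < n" for i
      proof -
        have ri: "r i \<in> R" "e i \<in> R" using r e i by (auto simp: free_module_simps)
        have q: "(r \<ominus>\<^bsub>?FR\<^esub> e) i = r i \<ominus>\<^bsub>T\<^esub> e i"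
          using free_module_minus[OF R.is_cring r e] i subring_minus[OF T R ri] by simp
        have "r i \<in> carrier T" "e i \<in> carrier T" using ri RT by auto
        \<comment> \<open>Congruence modulo \<open>C\<close> is tested on this difference, which is
          the entry \<open>e i\<close> of \<open>C\<close>.\<close>
        then have "r i \<ominus>\<^bsub>T\<^esub> (r i \<ominus>\<^bsub>T\<^esub> e i) = e i"
          by (simp add: a_minus_def T.minus_add T.r_neg1 T.r_neg2)
        moreover have "r i \<ominus>\<^bsub>T\<^esub> e i \<in> R"
          using R.minus_closed[of "r i" "e i"] ri subring_minus[OF T R ri] by simp
        ultimately show ?thesis unfolding q using \<eta>eq[OF ri(1), of "r i \<ominus>\<^bsub>T\<^esub> e i"] eC[OF i] by metis
      qed
      then have "?\<pi> (r \<ominus>\<^bsub>?FR\<^esub> e) = ?\<pi> r" by (intro restrict_ext) auto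
      then show ?thesis using \<pi>r by simp
    qed
    ultimately show ?thesis by blast
  qed
  have "\<forall>w\<in>GA. \<exists>r. r \<in> ?S \<and> ?\<pi> r = w" using lift GA(1) by blast
  from bchoice[OF this] obtain L where L: "\<forall>w\<in>GA. L w \<in> ?S \<and> ?\<pi> (L w) = w" by (elim exE)
  define G2 where "G2 = L ` GA"
  have G2: "G2 \<subseteq> ?S" "finite G2" using L GA(2) by (auto simp: G2_def)
  have "?\<pi> ` G2 = (\<lambda>w. w) ` GA"
    unfolding G2_def image_image by (rule image_cong[OF refl]) (use L in blast)
  then have \<pi>G2: "?\<pi> ` G2 = GA" by simp
  have GF: "G1 \<union> G2 \<subseteq> carrier ?FR" "G1 \<subseteq> carrier ?FR" "G2 \<subseteq> carrier ?FR"
    using G1(1) G2(1) by (auto simp: syzygies_def)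
  have "k \<in> lin_span ?R ?FR (G1 \<union> G2)" if k: "k \<in> ?S" for k
  proof -
    have kF: "k \<in> carrier ?FR" using k by (simp add: syzygies_def)
    have "?\<pi> k \<in> syzygies ?A n ?y"
    proof -
      have "k i \<in> R" if "i < n" for i using kF that by (auto simp: free_module_simps)
      then have "?\<pi> k \<in> carrier ?FA"
        unfolding free_module_simps restrict_PiE_iff by (intro ballI \<eta>c) simp
      then show ?thesis
        using ring_comb_hom[OF R.is_cring A \<eta> xR kF] k \<eta>.hom_zero by (simp add: syzygies_def)
    qed
    then have "?\<pi> k \<in> lin_span ?A ?FA (?\<pi> ` G2)" unfolding \<pi>G2 by (rule subsetD[OF GA(3)])
    from lift_span_along_hom[OF R.is_cring A \<eta> \<eta>s GF(3) this]
    obtain k' where k': "k' \<in> lin_span ?R ?FR G2" "?\<pi> k = ?\<pi> k'" by (elim bexE) (rule that)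
    have k'S: "k' \<in> ?S" by (rule subsetD[OF R.span_syzygies[OF xR G2(1)] k'(1)])
    have k'F: "k' \<in> carrier ?FR" using k'S by (simp add: syzygies_def)
    \<comment> \<open>\<open>k\<close> and \<open>k'\<close> have the same residues, so
      \<open>m\<close> is a syzygy over \<open>R\<close> with all entries in \<open>C\<close>, and
      those entries can be divided by \<open>c\<close>.\<close>
    define m where "m = k \<ominus>\<^bsub>?FR\<^esub> k'"
    have mF: "m \<in> carrier ?FR" unfolding m_def by (rule FR.M.minus_closed[OF kF k'F])
    have mS: "m \<in> ?S"
    proof -
      have "lin_span ?R ?FR ?S \<subseteq> ?S" by (rule R.span_syzygies[OF xR subset_refl])
      moreover have "?S \<subseteq> carrier ?FR" by (auto simp: syzygies_def)
      ultimately show ?thesis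
        unfolding m_def using FR.span_diff[of ?S k k'] subsetD[OF FR.span_incl[of ?S]] k k'S
        by (meson subsetD)
    qed
    have "m i \<in> C" if i: "i < n" for i
    proof -
      have ki: "k i \<in> R" "k' i \<in> R" using kF k'F i by (auto simp: free_module_simps)
      have "?\<eta> (k i) = ?\<eta> (k' i)" using fun_cong[OF k'(2), of i] i by simp
      moreover have "m i = k i \<ominus>\<^bsub>T\<^esub> k' i"
        unfolding m_def using free_module_minus[OF R.is_cring kF k'F] i subring_minus[OF T R ki] by simp
      ultimately show ?thesis using \<eta>eq[OF ki] by simp
    qed
    then have "\<forall>i\<in>{..<n}. \<exists>t. t \<in> carrier T \<and> m i = c \<otimes>\<^bsub>T\<^esub> t" using c(3) by blast
    then obtain t0 where t0: "\<And>i. i < n \<Longrightarrow> t0 i \<in> carrier T \<and> m i = c \<otimes>\<^bsub>T\<^esub> t0 i"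
      by (metis lessThan_iff)
    define t where "t = (\<lambda>i\<in>{..<n}. t0 i)"
    have tF: "t \<in> carrier ?F" using t0 by (simp add: t_def free_module_simps)
    have mt: "m = c \<odot>\<^bsub>?F\<^esub> t"
      using t0 mF by (auto simp: t_def free_module_simps PiE_iff extensional_def fun_eq_iff)
    \<comment> \<open>The combination of \<open>m\<close> is \<open>c\<close> times that of
      \<open>t\<close>; regularity of \<open>c\<close> then makes \<open>t\<close> a syzygy over
      \<open>T\<close>.\<close>
    have "c \<otimes>\<^bsub>T\<^esub> ring_comb T n x t = \<zero>\<^bsub>T\<^esub>"
      using T.ring_comb_smult[OF xT tF cT] mS comb[OF mF] mt by (simp add: syzygies_def)
    then have "t \<in> ?ST"
      using c(2) T.ring_comb_closed[OF xT tF] tF by (simp add: non_zero_divisor_def syzygies_def)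
    then have "t \<in> lin_span T ?F G1" using G1(3) by blast
    moreover have "G1 \<subseteq> carrier ?F" using GF(2) free_module_subring[OF T R] by blast
    moreover have "c \<otimes>\<^bsub>T\<^esub> a \<in> R" if "a \<in> carrier T" for a
      using CT.I_r_closed[OF c(1) that] CR by blast
    ultimately have "m \<in> lin_span ?R ?FR G1"
      unfolding mt using smult_span_subring[OF T cT] by blast
    then have "m \<in> lin_span ?R ?FR (G1 \<union> G2)" using span_mono[of G1 "G1 \<union> G2"] by blast
    moreover have "k' \<in> lin_span ?R ?FR (G1 \<union> G2)" using k'(1) span_mono[of G2 "G1 \<union> G2"] by blast
    ultimately have "m \<oplus>\<^bsub>?FR\<^esub> k' \<in> lin_span ?R ?FR (G1 \<union> G2)" by (rule FR.span_add[OF GF(1)])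
    moreover have "m \<oplus>\<^bsub>?FR\<^esub> k' = k"
      unfolding m_def a_minus_def using kF k'F by (simp add: FR.M.a_assoc FR.M.l_neg)
    ultimately show ?thesis by simp
  qed
  then show ?thesis
    unfolding finitely_spanned_def using G1(1,2) G2 by (intro exI[of _ "G1 \<union> G2"]) blast
qed

text \<open>Treats families generating the zero ideal, about which the hypothesis on non-zero ideals
  says nothing. Every coefficient vector is then a syzygy, and the unit vectors span.\<close>

lemma (in cring) finitely_spanned_syzygies_zero:
  assumes "\<And>i. i < n \<Longrightarrow> x i = \<zero>"
  shows "finitely_spanned R (free_module R n) (syzygies R n x)"
proof -
  interpret F: module R "free_module R n" by (rule module_free_module[OF is_cring])
  have "ring_comb R n x r = \<zero>" if "r \<in> carrier (free_module R n)" for r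
  proof -
    have "ring_comb R n x r = (\<Oplus>i\<in>{..<n}. \<zero>)"
      unfolding ring_comb_def using that assms
      by (intro finsum_cong') (auto simp: free_module_simps PiE_iff)
    then show ?thesis by simp
  qed
  then have "syzygies R n x = carrier (free_module R n)" by (auto simp: syzygies_def)
  moreover have "unit_vec R n ` {..<n} \<subseteq> carrier (free_module R n)"
    using F.unit_vec_closed[of n] by blast
  ultimately show ?thesis
    unfolding finitely_spanned_def using F.free_module_span[of n]
    by (intro exI[of _ "unit_vec R n ` {..<n}"]) simp
qed

text \<open>An isomorphism commutes with linear combinations: injectivity preserves and reflects
  their vanishing, and surjectivity makes the images of the generators generate
  \<open>J\<close>.\<close>

lemma (in cring) module_iso_genideal:
  assumes x: "x \<in> {..<n} \<rightarrow> carrier R" and J: "ideal J R"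
    and \<phi>: "\<phi> \<in> linear_maps R (mult_module R (Idl (x ` {..<n}))) (mult_module R J)"
      "bij_betw \<phi> (Idl (x ` {..<n})) J"
  shows "syzygies R n (\<lambda>i. \<phi> (x i)) = syzygies R n x"
    and "J = ring_comb R n (\<lambda>i. \<phi> (x i)) ` carrier (free_module R n)"
proof -
  let ?I = "Idl (x ` {..<n})"
  let ?M = "mult_module R ?I"
  let ?N = "mult_module R J"
  have xs: "x ` {..<n} \<subseteq> carrier R" using x by auto
  have I: "ideal ?I R" by (rule genideal_ideal[OF xs])
  have xI: "x \<in> {..<n} \<rightarrow> ?I" using genideal_self[OF xs] by auto
  interpret M: module R ?M by (rule module_mult_module_ideal[OF is_cring I])
  interpret N: module R ?N by (rule module_mult_module_ideal[OF is_cring J])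
  have xM: "x \<in> {..<n} \<rightarrow> carrier ?M" using xI by (simp add: mult_module_simps)
  have yJ: "(\<lambda>i. \<phi> (x i)) \<in> {..<n} \<rightarrow> J"
    using xI linear_mapsD(1)[OF \<phi>(1)] by (auto simp: mult_module_simps)
  then have yN: "(\<lambda>i. \<phi> (x i)) \<in> {..<n} \<rightarrow> carrier ?N" by (simp add: mult_module_simps)
  have eq: "\<phi> (ring_comb R n x r) = ring_comb R n (\<lambda>i. \<phi> (x i)) r"
    if r: "r \<in> carrier (free_module R n)" for r
  proof -
    have "\<phi> (lincomb ?M n x r) = lincomb ?N n (\<lambda>i. \<phi> (lincomb ?M n x (unit_vec R n i))) r"
      by (rule N.linear_eq_lincomb[OF linear_map_comp[OF M.lincomb_linear[OF xM] \<phi>(1)] r])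
    also have "\<dots> = lincomb ?N n (\<lambda>i. \<phi> (x i)) r"
      by (rule N.lincomb_cong[OF r _ yN]) (simp add: M.lincomb_unit[OF xM])
    finally show ?thesis
      by (simp add: lincomb_mult_module[OF I xI r] lincomb_mult_module[OF J yJ r])
  qed
  have \<phi>0: "\<phi> \<zero> = \<zero>"
    using linear_map_zero[OF M.module_axioms N.module_axioms \<phi>(1)] by (simp add: mult_module_simps)
  have I_eq: "?I = ring_comb R n x ` carrier (free_module R n)" by (rule genideal_eq_ring_comb[OF x])
  have zero: "\<zero> \<in> ?I"
    using lin_span.zero[of "mult_module R (carrier R)" R "x ` {..<n}"] genideal_eq_span[OF xs]
    by (simp add: mult_module_simps)
  have "ring_comb R n (\<lambda>i. \<phi> (x i)) r = \<zero> \<longleftrightarrow> ring_comb R n x r = \<zero>"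
    if r: "r \<in> carrier (free_module R n)" for r
  proof -
    have "ring_comb R n x r \<in> ?I" using I_eq r by blast
    then show ?thesis
      using inj_on_eq_iff[OF bij_betw_imp_inj_on[OF \<phi>(2)] _ zero] \<phi>0 eq[OF r] by metis
  qed
  then show "syzygies R n (\<lambda>i. \<phi> (x i)) = syzygies R n x" unfolding syzygies_def by blast
  have "J = \<phi> ` ?I" using bij_betw_imp_surj_on[OF \<phi>(2)] by simp
  also have "\<dots> = ring_comb R n (\<lambda>i. \<phi> (x i)) ` carrier (free_module R n)"
    unfolding I_eq image_image by (rule image_cong[OF refl eq])
  finally show "J = ring_comb R n (\<lambda>i. \<phi> (x i)) ` carrier (free_module R n)" .
qed

text \<open>Any generator \<open>c\<close> divides the regular element \<open>d\<close> supplied by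
  regularity of the square, and whatever \<open>c\<close> annihilates is annihilated by
  \<open>d\<close>.\<close>

lemma regular_principal_conductor:
  assumes "regular_conductor_square T R C" "principalideal C T"
  obtains c where "c \<in> C" "non_zero_divisor T c" "\<And>d. d \<in> C \<Longrightarrow> \<exists>t\<in>carrier T. d = c \<otimes>\<^bsub>T\<^esub> t"
proof -
  interpret T: cring T
    using assms(1) by (simp add: regular_conductor_square_def conductor_square_def)
  obtain c where c: "c \<in> carrier T" "C = Idl\<^bsub>T\<^esub> {c}"
    using principalideal.generate[OF assms(2)] by blast
  have C: "C = PIdl\<^bsub>T\<^esub> c" using c T.cgenideal_eq_genideal by simp
  have gen: "\<exists>t\<in>carrier T. d = c \<otimes>\<^bsub>T\<^esub> t" if "d \<in> C" for d
    using that c(1) T.m_comm unfolding C cgenideal_def by auto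
  obtain d where d: "d \<in> C" "non_zero_divisor T d"
    using assms(1) by (auto simp: regular_conductor_square_def)
  obtain t where t: "t \<in> carrier T" "d = c \<otimes>\<^bsub>T\<^esub> t" using gen[OF d(1)] by blast
  have "y = \<zero>\<^bsub>T\<^esub>" if y: "y \<in> carrier T" "c \<otimes>\<^bsub>T\<^esub> y = \<zero>\<^bsub>T\<^esub>" for y
  proof -
    have "d \<otimes>\<^bsub>T\<^esub> y = t \<otimes>\<^bsub>T\<^esub> (c \<otimes>\<^bsub>T\<^esub> y)" using t y(1) c(1) by (simp add: T.m_ac)
    then have "d \<otimes>\<^bsub>T\<^esub> y = \<zero>\<^bsub>T\<^esub>" using y(2) t(1) by simp
    then show ?thesis using d(2) y(1) by (auto simp: non_zero_divisor_def)
  qed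
  then have "non_zero_divisor T c" using c(1) by (auto simp: non_zero_divisor_def)
  moreover have "c \<in> C" unfolding C by (rule T.cgenideal_self[OF c(1)])
  ultimately show thesis using that gen by blast
qed

section \<open>Coherence of \<open>R\<close> and of \<open>T\<close>\<close>

theorem theorem4p5:
  fixes T :: "('a, 'p) ring_scheme" and R C :: "'a set"
  assumes "regular_conductor_square T R C"
    and "flat_module (T\<lparr>carrier := R\<rparr>) (mult_module T (carrier T))"
    and "principalideal C T"
    and "\<And>I. fg_ideal I (T\<lparr>carrier := R\<rparr>) \<Longrightarrow> I \<noteq> {\<zero>\<^bsub>T\<^esub>} \<Longrightarrow>
           \<exists>I'. ideal I' (T\<lparr>carrier := R\<rparr>) \<and>
             module_iso (T\<lparr>carrier := R\<rparr>)
               (mult_module (T\<lparr>carrier := R\<rparr>) I) (mult_module (T\<lparr>carrier := R\<rparr>) I') \<and>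
             Idl\<^bsub>T\<^esub> I' = carrier T"
    and "coherent_ring (T\<lparr>carrier := R\<rparr> Quot C)"
  shows "coherent_ring (T\<lparr>carrier := R\<rparr>) \<and> coherent_ring T"
proof -
  let ?R = "T\<lparr>carrier := R\<rparr>"
  have T: "cring T" and R: "subcring R T" and C: "ideal C T" "ideal C ?R"
    using assms(1)
    by (simp_all add: regular_conductor_square_def conductor_square_def common_ideal_def)
  interpret T: cring T by (rule T)
  have RT: "R \<subseteq> carrier T" using subcringE(1)[OF R] .
  interpret R: cring ?R using T.subcring_iff R RT by blast
  interpret CT: ideal C T by (rule C(1))
  have CR: "C \<subseteq> R" using ideal.Icarr[OF C(2)] by auto
  obtain c where c: "c \<in> C" "non_zero_divisor T c"
    "\<And>d. d \<in> C \<Longrightarrow> \<exists>t\<in>carrier T. d = c \<otimes>\<^bsub>T\<^esub> t"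
    using regular_principal_conductor[OF assms(1,3)] by blast
  have cT: "c \<in> carrier T" using c(2) by (simp add: non_zero_divisor_def)

  have R_fin: "finitely_spanned ?R (free_module ?R n) (syzygies ?R n x)"
    if x: "x \<in> {..<n} \<rightarrow> carrier ?R" for n and x :: "nat \<Rightarrow> 'a"
  proof (cases "Idl\<^bsub>?R\<^esub> (x ` {..<n}) = {\<zero>\<^bsub>T\<^esub>}")
    case True
    have "x ` {..<n} \<subseteq> Idl\<^bsub>?R\<^esub> (x ` {..<n})" using x by (intro R.genideal_self) auto
    then show ?thesis using True by (intro R.finitely_spanned_syzygies_zero) auto
  next
    case False
    obtain J \<phi> where J: "ideal J ?R" "Idl\<^bsub>T\<^esub> J = carrier T"
      and \<phi>: "\<phi> \<in> linear_maps ?R (mult_module ?R (Idl\<^bsub>?R\<^esub> (x ` {..<n}))) (mult_module ?R J)"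
        "bij_betw \<phi> (Idl\<^bsub>?R\<^esub> (x ` {..<n})) J"
      using assms(4)[OF R.fg_idealI[OF x] False] by (auto simp: module_iso_def mult_module_simps)
    let ?y = "\<lambda>i. \<phi> (x i)"
    note iso = R.module_iso_genideal[OF x J(1) \<phi>]
    have xs: "x ` {..<n} \<subseteq> carrier ?R" using x by auto
    have y: "?y \<in> {..<n} \<rightarrow> R"
    proof (rule Pi_I)
      fix i assume "i \<in> {..<n}"
      then have "x i \<in> Idl\<^bsub>?R\<^esub> (x ` {..<n})" using R.genideal_self[OF xs] by blast
      then have "\<phi> (x i) \<in> J" using bij_betwE[OF \<phi>(2)] by blast
      then show "\<phi> (x i) \<in> R" using ideal.Icarr[OF J(1)] by simp
    qed
    then have yT: "?y \<in> {..<n} \<rightarrow> carrier T" using RT by blast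
    \<comment> \<open>The new family generates \<open>J\<close> over \<open>R\<close>, and the same
      coefficients serve over \<open>T\<close>. As \<open>J\<close> spans the unit ideal of
      \<open>T\<close>, so does the family.\<close>
    have "J \<subseteq> Idl\<^bsub>T\<^esub> (?y ` {..<n})"
    proof
      fix b assume "b \<in> J"
      then obtain r where r: "r \<in> carrier (free_module ?R n)" "b = ring_comb ?R n ?y r"
        using iso(2) by blast
      then have "b = ring_comb T n ?y r" using ring_comb_subring[OF T R y] by simp
      then show "b \<in> Idl\<^bsub>T\<^esub> (?y ` {..<n})"
        using T.genideal_eq_ring_comb[OF yT] free_module_subring[OF T R r(1)] by blast
    qed
    moreover have yI: "ideal (Idl\<^bsub>T\<^esub> (?y ` {..<n})) T" using yT by (intro T.genideal_ideal) auto
    ultimately have "carrier T \<subseteq> Idl\<^bsub>T\<^esub> (?y ` {..<n})"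
      using T.genideal_minimal[OF yI, of J] J(2) by simp
    then have "Idl\<^bsub>T\<^esub> (?y ` {..<n}) = carrier T" using ideal.Icarr[OF yI] by blast
    from finitely_spanned_syzygies_subring[OF T R assms(2) C(2,1) c assms(5) y this]
    show ?thesis unfolding iso(1) .
  qed
  then have "coherent_ring ?R" using R.coherent_ring_iff_syzygies by blast

  moreover have "finitely_spanned T (free_module T n) (syzygies T n x)"
    if x: "x \<in> {..<n} \<rightarrow> carrier T" for n and x :: "nat \<Rightarrow> 'a"
  proof -
    \<comment> \<open>The entries lie in \<open>C\<close>, an ideal of \<open>T\<close> contained in
      \<open>R\<close>; regularity of \<open>c\<close> keeps the syzygies over \<open>T\<close>
      unchanged.\<close>
    let ?y = "\<lambda>i. x i \<otimes>\<^bsub>T\<^esub> c"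
    have y: "?y \<in> {..<n} \<rightarrow> R" using x CT.I_l_closed[OF c(1)] CR by blast
    then have yR: "?y \<in> {..<n} \<rightarrow> carrier ?R" by simp
    have ST: "syzygies T n ?y = syzygies T n x"
    proof -
      have "ring_comb T n ?y r = \<zero>\<^bsub>T\<^esub> \<longleftrightarrow> ring_comb T n x r = \<zero>\<^bsub>T\<^esub>"
        if r: "r \<in> carrier (free_module T n)" for r
      proof -
        have rx: "r i \<in> carrier T" "x i \<in> carrier T" if "i < n" for i
          using r x that by (auto simp: free_module_simps)
        have "ring_comb T n ?y r = (\<Oplus>\<^bsub>T\<^esub>i\<in>{..<n}. r i \<otimes>\<^bsub>T\<^esub> x i \<otimes>\<^bsub>T\<^esub> c)"
          unfolding ring_comb_def using rx cT
          by (intro T.finsum_cong') (auto simp: T.m_assoc)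
        also have "\<dots> = ring_comb T n x r \<otimes>\<^bsub>T\<^esub> c"
          unfolding ring_comb_def using rx cT by (subst T.finsum_ldistr) auto
        also have "\<dots> = c \<otimes>\<^bsub>T\<^esub> ring_comb T n x r"
          using T.ring_comb_closed[OF x r] cT by (rule T.m_comm)
        finally show ?thesis
          using c(2) T.ring_comb_closed[OF x r] cT by (auto simp: non_zero_divisor_def)
      qed
      then show ?thesis unfolding syzygies_def by blast
    qed
    obtain G where G: "G \<subseteq> syzygies ?R n ?y" "finite G"
      "syzygies ?R n ?y \<subseteq> lin_span ?R (free_module ?R n) G"
      using R_fin[OF yR] unfolding finitely_spanned_def by blast
    have sub: "syzygies ?R n ?y \<subseteq> syzygies T n ?y"
      using ring_comb_subring[OF T R y] free_module_subring[OF T R] by (auto simp: syzygies_def)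
    interpret F: module T "free_module T n" by (rule module_free_module[OF T])
    have GF: "G \<subseteq> carrier (free_module T n)" using G(1) sub by (auto simp: syzygies_def)
    have "syzygies ?R n ?y \<subseteq> lin_span T (free_module T n) G"
      using G(3) lin_span_subring[OF RT] by (rule subset_trans)
    \<comment> \<open>Flatness enters again: the syzygies over \<open>T\<close> are spanned by those
      over \<open>R\<close>, and these already lie in the \<open>T\<close>-span of
      \<open>G\<close>.\<close>
    from F.span_least[OF GF this]
    have "syzygies T n ?y \<subseteq> lin_span T (free_module T n) G"
      using flat_syzygies[OF T R assms(2) y] by (rule subset_trans[rotated])
    then show ?thesis
      unfolding ST[symmetric] finitely_spanned_def using G(1,2) sub by (intro exI[of _ G]) blast
  qed
  then have "coherent_ring T" using T.coherent_ring_iff_syzygies by blast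
  ultimately show ?thesis ..
qed

end
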